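(* Let $G$ be a three-dimensional unimodular Lie group with a left-invariant metric $\langle\cdot,\cdot\rangle$, and let $L\colon\mathfrak{g}\to\mathfrak{g}$ be a self-adjoint operator with $[a,b]=L(a\times b)$ for all $a,b\in\mathfrak{g}$. Let $u(t)$ be a nonsteady solution of the Euler-Arnold equation $u'=-u\times Lu$ with $\langle u,u\rangle=1$, let $\ell=\langle u,Lu\rangle$ (constant in time), and define $$\delta=|u'|^2,\quad v=\delta^{-1}u',\quad w=Lu-\ell u,\quad \xi=\delta^{-2}\langle u\times Lu,\;u\times L^2u-L(u\times Lu)\rangle .$$ Let $y(t)=p(t)u(t)+q(t)v(t)+r(t)w(t)$ for functions $p,q,r\colon[0,\tau]\to\mathbb{R}$ which vanish at both $t=0$ and $t=\tau$. Then the index form along the corresponding geodesic $\gamma$, with $\gamma'(t)=DL_{\gamma(t)}u(t)$, is $$I(y,y)=\int_0^\tau p'^2+\delta(r'+\xi q)^2+\delta^{-1}q'^2-\ell\xi q^2\,dt .$$ In particular, if $\xi(t)\le 0$ for all $t$, then there are no conjugate points along the geodesic, while if both $\delta(t)$ and $\xi(t)$ are bounded below by positive constants $\delta_0$ and $\xi_0$ respectively, then there is a conjugate point no later than $\tau:=2\pi/\sqrt{\ell\xi_0\delta_0}$.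
   Context: $\mathfrak{g}$ is the Lie algebra of $G$, and $\times$ is the usual three-dimensional cross product on $\mathfrak{g}\cong\mathbb{R}^3$ (with respect to the inner product $\langle\cdot,\cdot\rangle$ and an orientation); for a unimodular 3-dimensional Lie algebra a self-adjoint $L$ with $[a,b]=L(a\times b)$ exists (Milnor). In $DL_{\gamma(t)}$, $L_g$ denotes left translation by $g$. A solution $u$ is nonsteady if it is not constant; then $u'(t)\neq0$ for all $t$, so $\delta>0$, and $u,v,w$ form an orthogonal basis of $\mathfrak{g}$. The index form of a vector field $Y=DL_{\gamma}y$ along $\gamma$ vanishing at $0$ and $\tau$ is $I(y,y)=\int_0^\tau \langle \frac{DY}{dt},\frac{DY}{dt}\rangle-\langle R(Y,\gamma')\gamma',Y\rangle\,dt$, with $\frac{D}{dt}$ the covariant derivative and $R$ the curvature tensor signed so that $\langle R(a,b)b,a\rangle$ is the sectional curvature for orthonormal $a,b$. A conjugate point at time $t_0>0$ means that a nontrivial Jacobi field along $\gamma$ vanishes at $0$ and $t_0$.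
   Formalization: The claim of no conjugate points is proved under the added assumption ℓ ≥ 0 (it fails for ℓ < 0, e.g. on Berger spheres with L negative definite), and the existence of a conjugate point under ℓ > 0, which is needed for τ = 2π/√(ℓξ₀δ₀) to be defined. *)

theory Defs
  imports "HOL-Analysis.Analysis"
begin

section \<open>Smooth maps on open subsets of normed spaces\<close>

primrec Ck_on :: "nat \<Rightarrow> 'a::real_normed_vector set \<Rightarrow> ('a \<Rightarrow> 'b::real_normed_vector) \<Rightarrow> bool" where
  "Ck_on 0 S f \<longleftrightarrow> continuous_on S f"
| "Ck_on (Suc k) S f \<longleftrightarrow>
     (\<forall>x\<in>S. f differentiable (at x)) \<and> (\<forall>h. Ck_on k S (\<lambda>x. frechet_derivative f (at x) h))"

text \<open>Intended for open \<open>S\<close> in a finite-dimensional domain: all iterated directional derivatives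
  exist and are continuous.\<close>

definition smooth_on :: "'a::real_normed_vector set \<Rightarrow> ('a \<Rightarrow> 'b::real_normed_vector) \<Rightarrow> bool" where
  "smooth_on S f \<longleftrightarrow> (\<forall>k. Ck_on k S f)"


section \<open>Three-dimensional Lie groups\<close>

text \<open>A chart is a pair \<open>(U, \<phi>)\<close>; only the values of \<open>\<phi>\<close> on \<open>U\<close> matter.  As in the library
  class \<open>group_add\<close>, the group law is written \<open>+\<close> although it need not be commutative: \<open>g + h\<close>
  is the product, \<open>- g\<close> the inverse and \<open>0\<close> the identity element.  No connectedness is assumed.
  The second chart axiom says that \<open>\<phi>\<close> is a homeomorphism from the open set \<open>U\<close> onto an open subset
  of \<open>real^3\<close>; a class axiom can speak about the topology of \<open>'a\<close> only through \<open>open\<close>.\<close>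

class lie_group3 = topological_group_add + t2_space + second_countable_topology +
  fixes charts :: "('a set \<times> ('a \<Rightarrow> real^3)) set"
  assumes charts_cover: "(\<Union>(U, \<phi>)\<in>charts. U) = UNIV"
    and charts_homeomorphism: "(U, \<phi>) \<in> charts \<Longrightarrow>
      open U \<and> inj_on \<phi> U \<and> (\<forall>W\<subseteq>U. open W \<longleftrightarrow> open (\<phi> ` W))"
    and charts_compatible: "(U, \<phi>) \<in> charts \<Longrightarrow> (V, \<eta>) \<in> charts \<Longrightarrow>
      smooth_on (\<phi> ` (U \<inter> V)) (\<eta> \<circ> inv_into U \<phi>)"
    and smooth_plus: "(U, \<phi>) \<in> charts \<Longrightarrow> (V, \<eta>) \<in> charts \<Longrightarrow> (W, \<psi>) \<in> charts \<Longrightarrow>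
      smooth_on {(x, y). x \<in> \<phi> ` U \<and> y \<in> \<eta> ` V \<and> inv_into U \<phi> x + inv_into V \<eta> y \<in> W}
        (\<lambda>(x, y). \<psi> (inv_into U \<phi> x + inv_into V \<eta> y))"
    and smooth_uminus: "(U, \<phi>) \<in> charts \<Longrightarrow> (V, \<eta>) \<in> charts \<Longrightarrow>
      smooth_on {x. x \<in> \<phi> ` U \<and> - inv_into U \<phi> x \<in> V} (\<lambda>x. \<eta> (- inv_into U \<phi> x))"

definition smooth_fun :: "('g::lie_group3 \<Rightarrow> real) \<Rightarrow> bool" where
  "smooth_fun f \<longleftrightarrow> (\<forall>(U, \<phi>)\<in>charts. smooth_on (\<phi> ` U) (f \<circ> inv_into U \<phi>))"

definition smooth_curve_on :: "real set \<Rightarrow> (real \<Rightarrow> 'g::lie_group3) \<Rightarrow> bool" where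
  "smooth_curve_on I c \<longleftrightarrow> continuous_on I c \<and>
     (\<forall>(U, \<phi>)\<in>charts. smooth_on {t \<in> I. c t \<in> U} (\<phi> \<circ> c))"

text \<open>Tangent vectors are the velocities of smooth curves, acting on smooth functions.  So that
  equality of tangent vectors is equality of functionals, the value on a function that is not smooth
  is set to 0.\<close>

type_synonym 'g tvec = "('g \<Rightarrow> real) \<Rightarrow> real"

definition velocity :: "(real \<Rightarrow> 'g::lie_group3) \<Rightarrow> real \<Rightarrow> 'g tvec" where
  "velocity c t = (\<lambda>f. if smooth_fun f then deriv (f \<circ> c) t else 0)"

definition tangent_space :: "'g::lie_group3 \<Rightarrow> 'g tvec set" where
  "tangent_space p =
     {velocity c 0 | c \<epsilon>. 0 < \<epsilon> \<and> smooth_curve_on {-\<epsilon><..<\<epsilon>} c \<and> c 0 = p}"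

text \<open>The differential of left translation by \<open>g\<close>.\<close>

definition DL :: "'g::lie_group3 \<Rightarrow> 'g tvec \<Rightarrow> 'g tvec" where
  "DL g v = (\<lambda>f. v (\<lambda>h. f (g + h)))"

type_synonym 'g vfield = "'g \<Rightarrow> 'g tvec"

definition smooth_vfield :: "'g::lie_group3 vfield \<Rightarrow> bool" where
  "smooth_vfield X \<longleftrightarrow> (\<forall>p. X p \<in> tangent_space p) \<and>
     (\<forall>f. smooth_fun f \<longrightarrow> smooth_fun (\<lambda>p. X p f))"

definition lie_bracket :: "'g::lie_group3 vfield \<Rightarrow> 'g vfield \<Rightarrow> 'g vfield" where
  "lie_bracket X Y = (\<lambda>p f. X p (\<lambda>q. Y q f) - Y p (\<lambda>q. X q f))"

definition left_inv :: "'g::lie_group3 tvec \<Rightarrow> 'g vfield" where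
  "left_inv v = (\<lambda>g. DL g v)"

text \<open>The bracket of the Lie algebra, which is the tangent space at the identity.\<close>

definition la_bracket :: "'g::lie_group3 tvec \<Rightarrow> 'g tvec \<Rightarrow> 'g tvec" where
  "la_bracket v w = lie_bracket (left_inv v) (left_inv w) 0"


section \<open>Left-invariant metrics\<close>

text \<open>Smoothness of the metric follows from left invariance.\<close>

definition left_invariant_metric :: "('g::lie_group3 \<Rightarrow> 'g tvec \<Rightarrow> 'g tvec \<Rightarrow> real) \<Rightarrow> bool" where
  "left_invariant_metric M \<longleftrightarrow>
     (\<forall>p. \<forall>v\<in>tangent_space p. \<forall>w\<in>tangent_space p. M p v w = M p w v) \<and>
     (\<forall>p a b. \<forall>v\<in>tangent_space p. \<forall>w\<in>tangent_space p. \<forall>z\<in>tangent_space p.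
        M p (\<lambda>f. a * v f + b * w f) z = a * M p v z + b * M p w z) \<and>
     (\<forall>p. \<forall>v\<in>tangent_space p. v \<noteq> (\<lambda>f. 0) \<longrightarrow> 0 < M p v v) \<and>
     (\<forall>g p. \<forall>v\<in>tangent_space p. \<forall>w\<in>tangent_space p. M (g + p) (DL g v) (DL g w) = M p v w)"

text \<open>An identification of the Lie algebra with \<open>real^3\<close>, i.e. a choice of an orthonormal basis.
  The orientation of the Lie algebra is the one for which this basis is positive, so that
  \<open>cross3\<close> becomes the cross product of the Lie algebra.\<close>

definition orthonormal_iso ::
    "('g::lie_group3 \<Rightarrow> 'g tvec \<Rightarrow> 'g tvec \<Rightarrow> real) \<Rightarrow> (real^3 \<Rightarrow> 'g tvec) \<Rightarrow> bool" where
  "orthonormal_iso M \<iota> \<longleftrightarrow> (\<forall>f. linear (\<lambda>a. \<iota> a f)) \<and> bij_betw \<iota> UNIV (tangent_space 0) \<and>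
     (\<forall>a b. M 0 (\<iota> a) (\<iota> b) = a \<bullet> b)"

text \<open>Unimodularity of the Lie algebra: every \<open>ad\<close> has trace 0.\<close>

definition unimodular :: "(real^3 \<Rightarrow> 'g::lie_group3 tvec) \<Rightarrow> bool" where
  "unimodular \<iota> \<longleftrightarrow> (\<forall>a. trace (matrix (\<lambda>b. inv \<iota> (la_bracket (\<iota> a) (\<iota> b)))) = 0)"

text \<open>\<open>N X Y\<close> stands for the field \<open>\<nabla>\<^sub>X Y\<close>; it is constrained on smooth fields only.\<close>

definition levi_civita ::
    "('g::lie_group3 \<Rightarrow> 'g tvec \<Rightarrow> 'g tvec \<Rightarrow> real) \<Rightarrow> ('g vfield \<Rightarrow> 'g vfield \<Rightarrow> 'g vfield) \<Rightarrow> bool"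
where
  "levi_civita M N \<longleftrightarrow>
     (\<forall>X Y. smooth_vfield X \<longrightarrow> smooth_vfield Y \<longrightarrow> smooth_vfield (N X Y)) \<and>
     (\<forall>a b X Z Y. smooth_fun a \<longrightarrow> smooth_fun b \<longrightarrow>
        smooth_vfield X \<longrightarrow> smooth_vfield Z \<longrightarrow> smooth_vfield Y \<longrightarrow>
        N (\<lambda>p f. a p * X p f + b p * Z p f) Y = (\<lambda>p f. a p * N X Y p f + b p * N Z Y p f)) \<and>
     (\<forall>X Y Z. smooth_vfield X \<longrightarrow> smooth_vfield Y \<longrightarrow> smooth_vfield Z \<longrightarrow>
        N X (\<lambda>p f. Y p f + Z p f) = (\<lambda>p f. N X Y p f + N X Z p f)) \<and>
     (\<forall>a X Y. smooth_fun a \<longrightarrow> smooth_vfield X \<longrightarrow> smooth_vfield Y \<longrightarrow>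
        N X (\<lambda>p f. a p * Y p f) = (\<lambda>p f. X p a * Y p f + a p * N X Y p f)) \<and>
     (\<forall>X Y. smooth_vfield X \<longrightarrow> smooth_vfield Y \<longrightarrow>
        (\<lambda>p f. N X Y p f - N Y X p f) = lie_bracket X Y) \<and>
     (\<forall>X Y Z p. smooth_vfield X \<longrightarrow> smooth_vfield Y \<longrightarrow> smooth_vfield Z \<longrightarrow>
        X p (\<lambda>q. M q (Y q) (Z q)) = M p (N X Y p) (Z p) + M p (Y p) (N X Z p))"

text \<open>Since \<open>N\<close> is tensorial in its first argument and the curvature in all three, their values on
  vectors at \<open>p\<close> are computed from any smooth extensions; \<open>extend p v\<close> is the left-invariant one.\<close>

definition extend :: "'g::lie_group3 \<Rightarrow> 'g tvec \<Rightarrow> 'g vfield" where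
  "extend p v = left_inv (DL (- p) v)"

definition nabla_at ::
    "('g::lie_group3 vfield \<Rightarrow> 'g vfield \<Rightarrow> 'g vfield) \<Rightarrow> 'g \<Rightarrow> 'g tvec \<Rightarrow> 'g vfield \<Rightarrow> 'g tvec" where
  "nabla_at N p v X = N (extend p v) X p"

definition curvature ::
    "('g::lie_group3 vfield \<Rightarrow> 'g vfield \<Rightarrow> 'g vfield) \<Rightarrow> 'g vfield \<Rightarrow> 'g vfield \<Rightarrow> 'g vfield \<Rightarrow> 'g vfield"
where
  "curvature N X Y Z =
     (\<lambda>p f. N X (N Y Z) p f - N Y (N X Z) p f - N (lie_bracket X Y) Z p f)"

definition curvature_at ::
    "('g::lie_group3 vfield \<Rightarrow> 'g vfield \<Rightarrow> 'g vfield) \<Rightarrow> 'g \<Rightarrow> 'g tvec \<Rightarrow> 'g tvec \<Rightarrow> 'g tvec \<Rightarrow> 'g tvec"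
where
  "curvature_at N p a b c = curvature N (extend p a) (extend p b) (extend p c) p"


section \<open>Vector fields along a curve\<close>

text \<open>For the global frame \<open>E\<^sub>i = left_inv (\<iota> (axis i 1))\<close>, \<open>coords\<close> gives the coefficients of a
  tangent vector \<open>v = \<Sum>\<^sub>i y\<^sub>i E\<^sub>i(p) = DL p (\<iota> y)\<close>.\<close>

definition coords :: "(real^3 \<Rightarrow> 'g::lie_group3 tvec) \<Rightarrow> 'g \<Rightarrow> 'g tvec \<Rightarrow> real^3" where
  "coords \<iota> p v = (THE y. DL p (\<iota> y) = v)"

definition differentiable_along ::
    "(real^3 \<Rightarrow> 'g::lie_group3 tvec) \<Rightarrow> (real \<Rightarrow> 'g) \<Rightarrow> (real \<Rightarrow> 'g tvec) \<Rightarrow> real \<Rightarrow> bool" where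
  "differentiable_along \<iota> \<gamma> Y t \<longleftrightarrow> (\<lambda>s. coords \<iota> (\<gamma> s) (Y s)) differentiable (at t)"

text \<open>The covariant derivative along \<open>\<gamma>\<close>: if \<open>Y(t) = \<Sum>\<^sub>i y\<^sub>i(t) E\<^sub>i(\<gamma>(t))\<close>, then
  \<open>DY/dt = \<Sum>\<^sub>i y\<^sub>i' E\<^sub>i(\<gamma>(t)) + y\<^sub>i \<nabla>\<^sub>V E\<^sub>i\<close> with \<open>V = velocity \<gamma> t\<close>.\<close>

definition cov_deriv ::
    "('g vfield \<Rightarrow> 'g vfield \<Rightarrow> 'g vfield) \<Rightarrow> (real^3 \<Rightarrow> 'g::lie_group3 tvec) \<Rightarrow>
     (real \<Rightarrow> 'g) \<Rightarrow> (real \<Rightarrow> 'g tvec) \<Rightarrow> real \<Rightarrow> 'g tvec" where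
  "cov_deriv N \<iota> \<gamma> Y t =
     (let E = (\<lambda>i. left_inv (\<iota> (axis i 1)));
          y = (\<lambda>s. coords \<iota> (\<gamma> s) (Y s));
          y' = vector_derivative y (at t)
      in (\<lambda>f. \<Sum>i\<in>UNIV. y' $ i * E i (\<gamma> t) f + y t $ i * nabla_at N (\<gamma> t) (velocity \<gamma> t) (E i) f))"

definition index_form ::
    "('g \<Rightarrow> 'g tvec \<Rightarrow> 'g tvec \<Rightarrow> real) \<Rightarrow> ('g vfield \<Rightarrow> 'g vfield \<Rightarrow> 'g vfield) \<Rightarrow>
     (real^3 \<Rightarrow> 'g::lie_group3 tvec) \<Rightarrow> (real \<Rightarrow> 'g) \<Rightarrow> real \<Rightarrow> (real \<Rightarrow> 'g tvec) \<Rightarrow> real" where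
  "index_form M N \<iota> \<gamma> \<tau> Y = integral {0..\<tau>} (\<lambda>t.
     M (\<gamma> t) (cov_deriv N \<iota> \<gamma> Y t) (cov_deriv N \<iota> \<gamma> Y t) -
     M (\<gamma> t) (curvature_at N (\<gamma> t) (Y t) (velocity \<gamma> t) (velocity \<gamma> t)) (Y t))"

definition jacobi_field ::
    "('g vfield \<Rightarrow> 'g vfield \<Rightarrow> 'g vfield) \<Rightarrow> (real^3 \<Rightarrow> 'g::lie_group3 tvec) \<Rightarrow>
     (real \<Rightarrow> 'g) \<Rightarrow> (real \<Rightarrow> 'g tvec) \<Rightarrow> bool" where
  "jacobi_field N \<iota> \<gamma> J \<longleftrightarrow> (\<forall>t.
     J t \<in> tangent_space (\<gamma> t) \<and>
     differentiable_along \<iota> \<gamma> J t \<and> differentiable_along \<iota> \<gamma> (cov_deriv N \<iota> \<gamma> J) t \<and>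
     (\<forall>f. cov_deriv N \<iota> \<gamma> (cov_deriv N \<iota> \<gamma> J) t f +
          curvature_at N (\<gamma> t) (J t) (velocity \<gamma> t) (velocity \<gamma> t) f = 0))"

definition conjugate_time ::
    "('g vfield \<Rightarrow> 'g vfield \<Rightarrow> 'g vfield) \<Rightarrow> (real^3 \<Rightarrow> 'g::lie_group3 tvec) \<Rightarrow>
     (real \<Rightarrow> 'g) \<Rightarrow> real \<Rightarrow> bool" where
  "conjugate_time N \<iota> \<gamma> t\<^sub>0 \<longleftrightarrow> 0 < t\<^sub>0 \<and>
     (\<exists>J. jacobi_field N \<iota> \<gamma> J \<and> (\<exists>t. J t \<noteq> (\<lambda>f. 0)) \<and> J 0 = (\<lambda>f. 0) \<and> J t\<^sub>0 = (\<lambda>f. 0))"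

end

(*
  With K a = (tr L / 2) a - L a, the Koszul formula and L (a x b) = tr L (a x b) - L a x b - a x L b
  turn the Levi-Civita connection on left-invariant fields into (a, b) |-> K a x b.  The frame u, v, w
  satisfies v' + L w / delta = xi w, which gives the variation h = y' + L (u x y) the components
  p', q' + delta (p - l r), r' + xi q; the index integrand is then the stated one plus the derivative
  of K y . (u x y) + p q - l r q.

  The Jacobi equation is equivalent to y' = h - L (u x y), h' = - h x L u - u x L h, for which h . u
  and c = h . w are constant.  With s = q' / delta it reads p'' = 0, r' = c / delta - xi q,
  s' = xi (c - l q).  If xi <= 0 <= l, then p p' + c r + q s is nondecreasing, so a Jacobi field vanishing
  twice is zero.  For the conjugate point take the solutions (q1, r1), (q2, r2) with p = 0 and
  (s, c) = (1, 0), (0, 1) at time 0, and D = q1 r2 - q2 r1.  Where q1 = 0, the Wronskian gives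
  D = - (s1 - 1)^2 / (l^2 s1); by Sturm comparison q1 and s1 complete a full turn before 2 pi / sqrt (l xi0 delta0),
  so D changes sign between the first two zeros of q1.
*)
theory Submission
  imports Defs
begin

text \<open>Conjugate points are defined by Jacobi fields on the whole line, so both conclusions
  about them are read off the linear system for p, q, r, s, and global existence for that system is
  part of the proof. Reversing the orientation changes the signs of L, l and \<xi> together, and
  only l \<xi> is geometric. This is why a sign condition on \<xi> comes with one on l. For the
  conjugate point the obstacle is that a single solution need not vanish twice. Both r1' and s1' are
  multiples of \<xi> q1, so l r1 = s1 - 1, and q1 and r1 vanish together only where q1 = 0 and s1 =
  1. With constant coefficients this happens after one period; with variable ones a full turn may
  end at another positive value of s1. The determinant D repairs this: at a zero of D some
  nontrivial combination of the two solutions vanishes, and the sign of D at a zero of q1 depends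
  only on the sign of s1 there. The stated bound is the period of the system with constant
  coefficients \<delta>0, \<xi>0, reached as two half turns.\<close>

section \<open>Linear differential equations on the line\<close>

text \<open>Gronwall's argument for the squared norm \<open>f\<close>:
  \<open>f t * exp (-2 * K * t)\<close> is nonincreasing, which settles the times after
  \<open>t0\<close>, and \<open>f t * exp (2 * K * t)\<close> is nondecreasing, which settles those
  before.\<close>

lemma vector_derivative_bound_imp_zero:
  fixes x :: "real \<Rightarrow> 'a::real_inner"
  assumes deriv: "\<And>t. (x has_vector_derivative x' t) (at t)"
    and bound: "\<And>t. norm (x' t) \<le> K * norm (x t)"
    and zero: "x t0 = 0"
  shows "x t = 0"
proof -
  define f where "f t = x t \<bullet> x t" for t
  define f' where "f' t = 2 * (x t \<bullet> x' t)" for t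
  have f: "(f has_real_derivative f' t) (at t)" for t
    unfolding f_def f'_def has_real_derivative_iff_has_vector_derivative
    using bounded_bilinear.has_vector_derivative[OF bounded_bilinear_inner deriv deriv, of t]
    by (simp add: inner_commute)
  have f': "\<bar>f' t\<bar> \<le> 2 * K * f t" for t
  proof -
    have "\<bar>x t \<bullet> x' t\<bar> \<le> norm (x t) * norm (x' t)"
      by (rule Cauchy_Schwarz_ineq2)
    also have "\<dots> \<le> norm (x t) * (K * norm (x t))"
      by (intro mult_left_mono bound) simp
    also have "\<dots> = K * f t"
      by (simp add: f_def power2_norm_eq_inner[symmetric] power2_eq_square)
    finally show ?thesis by (simp add: f'_def abs_mult)
  qed
  have g: "((\<lambda>t. f t * exp (c * t)) has_real_derivative (f' t + c * f t) * exp (c * t)) (at t)" for c t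
    by (auto intro!: derivative_eq_intros f simp: algebra_simps)
  have "f t \<le> 0"
  proof (cases "t0 \<le> t")
    case True
    have "f t * exp (-2 * K * t) \<le> f t0 * exp (-2 * K * t0)"
    proof (rule DERIV_nonpos_imp_nonincreasing[OF True])
      fix s show "\<exists>y. ((\<lambda>t. f t * exp (-2 * K * t)) has_real_derivative y) (at s) \<and> y \<le> 0"
        using g[of "-2 * K" s] f'[of s] by (intro exI conjI) (auto simp: mult_le_0_iff)
    qed
    then show ?thesis using zero by (simp add: f_def mult_le_0_iff)
  next
    case False
    have "f t * exp (2 * K * t) \<le> f t0 * exp (2 * K * t0)"
    proof (rule DERIV_nonneg_imp_nondecreasing[of t t0 "\<lambda>t. f t * exp (2 * K * t)"])
      show "t \<le> t0" using False by simp
      fix s show "\<exists>y. ((\<lambda>t. f t * exp (2 * K * t)) has_real_derivative y) (at s) \<and> 0 \<le> y"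
        using g[of "2 * K" s] f'[of s] by (intro exI conjI) auto
    qed
    then show ?thesis using zero by (simp add: f_def mult_le_0_iff)
  qed
  then show ?thesis by (metis f_def inner_eq_zero_iff inner_ge_zero order_antisym)
qed

text \<open>Integrating the weight \<open>exp (2 * K * t)\<close> yields a factor
  \<open>1 / (2 * K)\<close>; against the \<open>K\<close> of the bound this leaves one half, the
  contraction factor of the Picard iteration.\<close>

lemma norm_le_half_exp_of_derivative_bound:
  fixes f :: "real \<Rightarrow> 'a::real_normed_vector"
  assumes deriv: "\<And>t. (f has_vector_derivative f' t) (at t)"
    and zero: "f 0 = 0" and "0 < K" "0 \<le> C"
    and bound: "\<And>t. norm (f' t) \<le> K * (C * exp (2 * K * \<bar>t\<bar>))"
  shows "norm (f t) \<le> C / 2 * exp (2 * K * \<bar>t\<bar>)"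
proof -
  have pos: "norm (f t) \<le> C / 2 * exp (2 * K * t)"
    if "0 < t" and deriv: "\<And>t. (f has_vector_derivative f' t) (at t)" and "f 0 = 0"
      and bound: "\<And>t. norm (f' t) \<le> K * (C * exp (2 * K * \<bar>t\<bar>))"
    for f f' :: "real \<Rightarrow> 'a" and t
  proof -
    have "norm (f t - f 0) \<le> C / 2 * exp (2 * K * t) - C / 2 * exp (2 * K * 0)"
    proof (rule differentiable_bound_general[OF \<open>0 < t\<close>])
      show "continuous_on {0..t} f"
        by (rule continuous_on_vector_derivative) (rule has_vector_derivative_at_within[OF deriv])
      show "continuous_on {0..t} (\<lambda>t. C / 2 * exp (2 * K * t))"
        by (intro continuous_intros)
      fix s :: real assume "0 < s"
      show "((\<lambda>t. C / 2 * exp (2 * K * t)) has_vector_derivative K * (C * exp (2 * K * s))) (at s)"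
        unfolding has_real_derivative_iff_has_vector_derivative[symmetric]
        by (auto intro!: derivative_eq_intros)
      show "norm (f' s) \<le> K * (C * exp (2 * K * s))"
        using bound[of s] \<open>0 < s\<close> by simp
    qed (use deriv in auto)
    with \<open>f 0 = 0\<close> \<open>0 \<le> C\<close> show ?thesis by simp
  qed
  consider "t = 0" | "t > 0" | "t < 0" by linarith
  then show ?thesis
  proof cases
    case 1 then show ?thesis using zero \<open>0 \<le> C\<close> by simp
  next
    case 2 then show ?thesis using pos[OF 2 deriv zero bound] by simp
  next
    case 3
    \<comment> \<open>Negative times are reduced to positive ones by reflection; \<open>pos\<close>
      is stated for arbitrary \<open>f\<close> and \<open>f'\<close> for this purpose.\<close>
    have "((\<lambda>s. f (- s)) has_vector_derivative - f' (- s)) (at s)" for s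
      using vector_diff_chain_at[OF has_vector_derivative_minus[OF has_vector_derivative_id] deriv, of s]
      by (simp add: o_def)
    from pos[OF _ this, of "- t"] 3 zero show ?thesis using bound[of "- s" for s] by simp
  qed
qed

lemma continuous_antiderivative_exists:
  fixes g :: "real \<Rightarrow> 'a::euclidean_space"
  assumes "continuous_on UNIV g"
  shows "\<exists>G. G 0 = a \<and> (\<forall>t. (G has_vector_derivative g t) (at t))"
proof -
  have "\<exists>F. \<forall>x::real. -\<infinity> < ereal x \<longrightarrow> ereal x < \<infinity> \<longrightarrow> (F has_vector_derivative g x) (at x)"
    using assms by (intro einterval_antiderivative) (auto simp: continuous_on_eq_continuous_at)
  then obtain F where F: "\<And>x. (F has_vector_derivative g x) (at x)" by auto
  have "((\<lambda>t. F t - F 0 + a) has_vector_derivative g t) (at t)" for t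
    by (auto intro!: derivative_eq_intros F)
  then show ?thesis by (intro exI[of _ "\<lambda>t. F t - F 0 + a"]) auto
qed

text \<open>In the norm weighted by \<open>exp (2 * K * \<bar>t\<bar>)\<close> each Picard step is a contraction with factor
  one half on the whole line, so the Picard series converges globally.\<close>

lemma linear_ode_solution_exists:
  fixes A :: "real \<Rightarrow> 'a::euclidean_space \<Rightarrow> 'a"
  assumes lin: "\<And>t. linear (A t)"
    and bound: "\<And>t x. norm (A t x) \<le> K * norm x"
    and cont: "\<And>x. continuous_on UNIV x \<Longrightarrow> continuous_on UNIV (\<lambda>t. A t (x t))"
  shows "\<exists>x. x 0 = a \<and> (\<forall>t. (x has_vector_derivative A t (x t)) (at t))"
proof -
  \<comment> \<open>The given bound may be zero or negative, whereas the contraction estimate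
    divides by a positive constant.\<close>
  define K' where "K' = \<bar>K\<bar> + 1"
  have K': "0 < K'" by (simp add: K'_def)
  have bound': "norm (A t x) \<le> K' * norm x" for t x
    using order_trans[OF bound[of t x] mult_right_mono[of K K' "norm x"]] by (simp add: K'_def)
  define step where "step x = (SOME G. G 0 = (0::'a) \<and> (\<forall>t. (G has_vector_derivative A t (x t)) (at t)))" for x
  have "step x 0 = 0 \<and> (\<forall>t. (step x has_vector_derivative A t (x t)) (at t))"
    if "continuous_on UNIV x" for x
    unfolding step_def
    by (rule someI_ex[where P="\<lambda>G. G 0 = 0 \<and> (\<forall>t. (G has_vector_derivative A t (x t)) (at t))"])
      (rule continuous_antiderivative_exists[OF cont[OF that]])
  then have step: "step x 0 = 0" "(step x has_vector_derivative A t (x t)) (at t)"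
    if "continuous_on UNIV x" for x t
    using that by blast+
  have step_cont: "continuous_on UNIV (step x)" if "continuous_on UNIV x" for x
    by (rule continuous_on_vector_derivative)
      (rule has_vector_derivative_at_within[OF step(2)[OF that]])
  define P where "P n = (step ^^ n) (\<lambda>t. a)" for n
  have P0: "P 0 = (\<lambda>t. a)" and PS: "P (Suc n) = step (P n)" for n
    by (simp_all add: P_def)
  have P_cont: "continuous_on UNIV (P n)" for n
    by (induction n) (simp_all only: P0 PS continuous_on_const step_cont)
  define E where "E t = exp (2 * K' * \<bar>t\<bar>)" for t
  have P_bound: "norm (P n t) \<le> norm a * (1/2)^n * E t" for n t
  proof (induction n arbitrary: t)
    case 0
    have "1 \<le> E t" using K' by (simp add: E_def)
    then show ?case using mult_left_mono[of 1 "E t" "norm a"] by (simp add: P0)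
  next
    case (Suc n)
    have "norm (P (Suc n) t) \<le> (norm a * (1/2)^n) / 2 * exp (2 * K' * \<bar>t\<bar>)"
      unfolding PS
    proof (rule norm_le_half_exp_of_derivative_bound[OF step(2)[OF P_cont] step(1)[OF P_cont] K'])
      fix t
      have "norm (A t (P n t)) \<le> K' * norm (P n t)" by (rule bound')
      also have "\<dots> \<le> K' * (norm a * (1/2)^n * E t)"
        using Suc K' by (intro mult_left_mono) auto
      finally show "norm (A t (P n t)) \<le> K' * (norm a * (1/2)^n * exp (2 * K' * \<bar>t\<bar>))"
        by (simp add: E_def)
    qed simp
    then show ?case by (simp add: E_def)
  qed
  define S where "S n t = (\<Sum>i<n. P i t)" for n t
  define x where "x t = (\<Sum>i. P i t)" for t
  have geo: "summable (\<lambda>n. norm a * (1/2)^n * E t)" for t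
    by (intro summable_mult2 summable_mult summable_geometric) simp
  have P_summable: "summable (\<lambda>n. P n t)" for t
    using summable_comparison_test'[OF geo P_bound] .
  have tail: "norm (x t - S n t) \<le> norm a * 2 * (1/2)^n * E t" for n t
  proof -
    have "x t - S n t = (\<Sum>i. P (i + n) t)"
      using suminf_minus_initial_segment[OF P_summable, of n t] by (simp add: x_def S_def)
    also have "norm \<dots> \<le> (\<Sum>i. norm a * (1/2)^(i + n) * E t)"
      by (rule norm_suminf_le[OF P_bound])
        (use geo[of t] in \<open>simp add: summable_iff_shift[of "\<lambda>n. norm a * (1/2)^n * E t"]\<close>)
    also have "\<dots> = (\<Sum>i. (norm a * (1/2)^n * E t) * (1/2)^i)"
      by (simp add: power_add mult_ac)
    also have "\<dots> = norm a * 2 * (1/2)^n * E t"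
      by (subst suminf_mult) (auto simp: suminf_geometric)
    finally show ?thesis .
  qed
  have S_cont: "continuous_on UNIV (S n)" for n
    unfolding S_def by (intro continuous_intros P_cont)
  have x_cont: "continuous_on UNIV x"
  proof -
    have "continuous_on {-R<..<R} x" for R
    proof (rule uniform_limit_theorem[where f=S and F=sequentially])
      show "\<forall>\<^sub>F n in sequentially. continuous_on {-R<..<R} (S n)"
        using S_cont continuous_on_subset by (intro always_eventually) blast
      show "uniform_limit {-R<..<R} S x sequentially"
      proof (rule uniform_limitI)
        fix e :: real assume "0 < e"
        have "(\<lambda>n. norm a * 2 * (1/2)^n * E R) \<longlonglongrightarrow> norm a * 2 * 0 * E R"
          by (intro tendsto_intros LIMSEQ_power_zero) simp
        then have "\<forall>\<^sub>F n in sequentially. norm a * 2 * (1/2)^n * E R < e"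
          using \<open>0 < e\<close> by (intro order_tendstoD) auto
        then show "\<forall>\<^sub>F n in sequentially. \<forall>t\<in>{-R<..<R}. dist (S n t) (x t) < e"
        proof eventually_elim
          case (elim n)
          show ?case
          proof
            fix t assume "t \<in> {-R<..<R}"
            then have "E t \<le> E R" using K' by (auto simp: E_def)
            then have "norm a * 2 * (1/2)^n * E t \<le> norm a * 2 * (1/2)^n * E R"
              by (intro mult_left_mono) auto
            from tail[of t n] this elim have "norm (x t - S n t) < e" by linarith
            then show "dist (S n t) (x t) < e"
              by (simp add: dist_norm norm_minus_commute)
          qed
        qed
      qed
    qed simp
    then have "isCont x t" for t
      by (rule continuous_on_interior[of "{- (\<bar>t\<bar> + 1)<..<\<bar>t\<bar> + 1}"]) (auto simp: interior_open)
    then show ?thesis by (simp add: continuous_on_eq_continuous_at)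
  qed
  \<comment> \<open>One further Picard step, applied to the limit. It is differentiable by
    construction, and comparing it with the partial sums identifies it with \<open>x\<close>, so the
    series is never differentiated termwise.\<close>
  define y where "y t = a + step x t" for t
  have y: "(y has_vector_derivative A t (x t)) (at t)" for t
    unfolding y_def by (auto intro!: derivative_eq_intros step(2)[OF x_cont])
  have "y t = x t" for t
  proof -
    have diff: "norm (y t - S (Suc n) t) \<le> norm a * 2 * (1/2)^n / 2 * E t" for n
      unfolding E_def
    proof (rule norm_le_half_exp_of_derivative_bound[OF _ _ K'])
      have S_Suc: "S (Suc n) s = a + (\<Sum>i<n. P (Suc i) s)" for s
        unfolding S_def by (subst sum.lessThan_Suc_shift) (simp add: P0)
      have "((\<lambda>s. y s - S (Suc n) s) has_vector_derivative A s (x s) - (\<Sum>i<n. A s (P i s))) (at s)" for s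
        unfolding S_Suc PS by (auto intro!: derivative_eq_intros y step(2) P_cont)
      also have "A s (x s) - (\<Sum>i<n. A s (P i s)) = A s (x s - S n s)" for s
        using lin[of s] by (simp add: linear_diff linear_sum S_def)
      finally show "((\<lambda>s. y s - S (Suc n) s) has_vector_derivative A s (x s - S n s)) (at s)" for s .
      show "y 0 - S (Suc n) 0 = 0"
        unfolding S_Suc PS by (simp add: y_def step(1) P_cont x_cont)
      fix s
      have "norm (A s (x s - S n s)) \<le> K' * norm (x s - S n s)" by (rule bound')
      also have "\<dots> \<le> K' * (norm a * 2 * (1/2)^n * exp (2 * K' * \<bar>s\<bar>))"
        using tail[of s n] K' by (intro mult_left_mono) (auto simp: E_def)
      finally show "norm (A s (x s - S n s)) \<le> K' * (norm a * 2 * (1/2)^n * exp (2 * K' * \<bar>s\<bar>))" .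
    qed simp
    have "(\<lambda>n. norm a * 2 * (1/2)^n / 2 * E t) \<longlonglongrightarrow> norm a * 2 * 0 / 2 * E t"
      by (intro tendsto_intros LIMSEQ_power_zero) simp_all
    then have "(\<lambda>n. norm (y t - S (Suc n) t)) \<longlonglongrightarrow> 0"
      using diff by (intro Lim_null_comparison[where f="\<lambda>n. norm (y t - S (Suc n) t)"]) auto
    then have "(\<lambda>n. S (Suc n) t) \<longlonglongrightarrow> y t"
      by (simp only: tendsto_norm_zero_iff norm_minus_commute[of "y t"] LIM_zero_iff)
    moreover have "(\<lambda>n. S (Suc n) t) \<longlonglongrightarrow> x t"
      using summable_LIMSEQ[OF P_summable, of t] unfolding S_def x_def by (rule LIMSEQ_Suc)
    ultimately show ?thesis by (rule LIMSEQ_unique)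
  qed
  then have "y = x" by auto
  with y have "\<forall>t. (x has_vector_derivative A t (x t)) (at t)" by simp
  moreover have "x 0 = a"
    using y_def[of 0] step(1)[OF x_cont] fun_cong[OF \<open>y = x\<close>, of 0] by simp
  ultimately show ?thesis by blast
qed

text \<open>Sturm comparison through the Pruefer angle. As long as \<open>q\<close> is positive,
  \<open>arctan (k * s t / q t)\<close> decreases at rate at least \<omega>; its range has length
  \<open>pi\<close>, so \<open>q\<close> returns to zero within time \<open>pi\<close> / \<omega>.
  At the first return \<open>q\<close> arrives from above, hence \<open>s\<close> is not positive
  there.\<close>

lemma half_turn:
  fixes q s f g :: "real \<Rightarrow> real"
  assumes q: "\<And>t. a \<le> t \<Longrightarrow> (q has_real_derivative f t * s t) (at t)"
    and s: "\<And>t. a \<le> t \<Longrightarrow> (s has_real_derivative - (g t * q t)) (at t)"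
    and f: "\<And>t. a \<le> t \<Longrightarrow> f0 \<le> f t" and g: "\<And>t. a \<le> t \<Longrightarrow> g0 \<le> g t"
    and "0 < f0" "0 < g0" and qa: "q a = 0" and sa: "0 < s a"
  shows "\<exists>b. a < b \<and> b \<le> a + pi / sqrt (f0 * g0) \<and> q b = 0 \<and> s b \<le> 0"
proof -
  define \<omega> where "\<omega> = sqrt (f0 * g0)"
  define T where "T = a + pi / \<omega>"
  have \<omega>: "0 < \<omega>" using \<open>0 < f0\<close> \<open>0 < g0\<close> by (simp add: \<omega>_def)
  have aT: "a < T" using \<omega> by (simp add: T_def)
  have "0 < f a * s a" using f[of a] \<open>0 < f0\<close> sa by simp
  from DERIV_pos_inc_right[OF q[of a] this] qa
  obtain e where e: "0 < e" "\<And>h. 0 < h \<Longrightarrow> h < e \<Longrightarrow> 0 < q (a + h)" by auto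
  have q_cont: "continuous_on {a..T} q"
    using q by (intro DERIV_continuous_on) (auto intro: has_field_derivative_at_within)
  \<comment> \<open>The zero at \<open>a\<close> is cut off together with an interval on which
    \<open>q\<close> is known to be positive; the remaining zeros form a compact set, so a first one
    exists.\<close>
  define Z where "Z = {t \<in> {a..T}. q t = 0} - {a..<a + e}"
  have "Z = {t \<in> {a..T}. q t = 0} \<inter> {a + e..}" by (auto simp: Z_def)
  moreover have "closed {t \<in> {a..T}. q t = 0}"
    using continuous_closed_preimage_constant[OF q_cont, of 0] by simp
  ultimately have "compact Z"
    by (auto simp: compact_eq_bounded_closed Z_def intro: bounded_subset[of "{a..T}"])
  have pos: "0 < q t" if "a < t" "t \<le> T" and none: "\<And>z. z \<in> Z \<Longrightarrow> t < z" for t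
  proof (rule ccontr)
    assume "\<not> 0 < q t"
    then have "q t \<le> 0" by simp
    define c where "c = a + min e (t - a) / 2"
    have c: "a < c" "c < a + e" "c < t" using e(1) \<open>a < t\<close> by (simp_all add: c_def min_def field_simps)
    then have "0 < q c" using e(2)[of "c - a"] by simp
    then obtain z where "c \<le> z" "z \<le> t" "q z = 0"
      using IVT2'[of q t 0 c] c \<open>q t \<le> 0\<close> \<open>t \<le> T\<close> continuous_on_subset[OF q_cont, of "{c..t}"] by auto
    moreover have "\<not> z < a + e"
      using e(2)[of "z - a"] c calculation by auto
    ultimately have "z \<in> Z" using c \<open>t \<le> T\<close> by (auto simp: Z_def)
    from none[OF this] \<open>z \<le> t\<close> show False by simp
  qed
  have "Z \<noteq> {}"
  proof
    assume "Z = {}"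
    then have q_pos: "0 < q t" if "a < t" "t \<le> T" for t using pos that by auto
    \<comment> \<open>This scaling balances the two lower bounds: \<open>k * g0\<close> and
      \<open>f0 / k\<close> both equal \<omega>, so the angle turns at least at rate \<omega> in
      every direction.\<close>
    define k where "k = sqrt (f0 / g0)"
    have k: "0 < k" "k * g0 = \<omega>" "f0 / k = \<omega>"
      using \<open>0 < f0\<close> \<open>0 < g0\<close>
      by (auto simp: k_def \<omega>_def real_sqrt_divide real_sqrt_mult field_simps)
    define \<theta> where "\<theta> t = arctan (k * s t / q t) + \<omega> * t" for t
    have mono: "\<theta> T \<le> \<theta> t" if t: "a < t" "t \<le> T" for t
    proof (rule DERIV_nonpos_imp_nonincreasing[OF \<open>t \<le> T\<close>])
      fix r assume r: "t \<le> r" "r \<le> T"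
      define x where "x = k * s r / q r"
      have "0 < q r" "a \<le> r" using q_pos r t by auto
      then have d: "(\<theta> has_real_derivative
          inverse (1 + x\<^sup>2) * (k * (- (g r * q r) * q r - s r * (f r * s r)) / (q r * q r)) + \<omega>) (at r)"
        unfolding \<theta>_def x_def
        by (auto intro!: derivative_eq_intros q s simp: field_simps)
      have "k * (- (g r * q r) * q r - s r * (f r * s r)) / (q r * q r) = - (k * g r + f r / k * x\<^sup>2)"
        using \<open>0 < q r\<close> k(1) by (simp add: x_def field_simps power2_eq_square)
      also have "\<dots> \<le> - (\<omega> + \<omega> * x\<^sup>2)"
      proof -
        have "\<omega> \<le> k * g r" using mult_left_mono[OF g[OF \<open>a \<le> r\<close>], of k] k by simp
        moreover have "\<omega> \<le> f r / k" using divide_right_mono[OF f[OF \<open>a \<le> r\<close>], of k] k by simp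
        then have "\<omega> * x\<^sup>2 \<le> f r / k * x\<^sup>2" by (rule mult_right_mono) simp
        ultimately show ?thesis by simp
      qed
      finally have "inverse (1 + x\<^sup>2) * (k * (- (g r * q r) * q r - s r * (f r * s r)) / (q r * q r))
          \<le> inverse (1 + x\<^sup>2) * (- (\<omega> * (1 + x\<^sup>2)))"
        by (intro mult_left_mono) (auto simp: algebra_simps)
      also have "\<dots> = - \<omega>"
        by (simp add: field_simps add_nonneg_eq_0_iff)
      finally show "\<exists>y. (\<theta> has_real_derivative y) (at r) \<and> y \<le> 0"
        using d by (intro exI[of _ "_ + \<omega>"] conjI) auto
    qed
    \<comment> \<open>For \<open>h\<close> tending to 0 this would give \<open>arctan\<close> a
      value at most \<open>- pi / 2\<close>. The limit is replaced by an \<open>h\<close> with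
      \<omega> \<open>h\<close> at most half of the positive gap \<open>d\<close>, which contradicts
      \<open>d\<close> \<le> \<omega> \<open>h\<close>.\<close>
    have "arctan (k * s T / q T) + pi \<le> pi / 2 + \<omega> * h" if h: "0 < h" "h \<le> T - a" for h
    proof -
      have "\<theta> T \<le> \<theta> (a + h)" using mono h by simp
      moreover have "\<theta> (a + h) \<le> pi / 2 + \<omega> * (a + h)"
        unfolding \<theta>_def using arctan_ubound[of "k * s (a + h) / q (a + h)"] by simp
      moreover have "\<omega> * T = \<omega> * a + pi" using \<omega> by (simp add: T_def field_simps)
      ultimately show ?thesis by (simp add: \<theta>_def algebra_simps)
    qed
    note * = this
    define d where "d = arctan (k * s T / q T) + pi / 2"
    have "0 < d" using arctan_lbound[of "k * s T / q T"] by (simp add: d_def)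
    define h where "h = min (T - a) (d / (2 * \<omega>))"
    have "0 < h" "h \<le> T - a" using aT \<omega> \<open>0 < d\<close> by (simp_all add: h_def)
    from *[OF this] have "d \<le> \<omega> * h" by (simp add: d_def)
    moreover have "\<omega> * h \<le> \<omega> * (d / (2 * \<omega>))" unfolding h_def using \<omega> by (intro mult_left_mono) auto
    ultimately show False using \<omega> \<open>0 < d\<close> by simp
  qed
  from compact_attains_inf[OF \<open>compact Z\<close> this]
  obtain b where b: "b \<in> Z" "\<And>z. z \<in> Z \<Longrightarrow> b \<le> z" by blast
  then have ab: "a < b" "b \<le> T" "q b = 0" using e by (auto simp: Z_def)
  \<comment> \<open>Otherwise \<open>q\<close> would be increasing at \<open>b\<close>, hence
    negative shortly before, although \<open>b\<close> is its first zero after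
    \<open>a\<close>.\<close>
  have "s b \<le> 0"
  proof (rule ccontr)
    assume "\<not> s b \<le> 0"
    then have "0 < f b * s b" using f[of b] \<open>0 < f0\<close> ab by simp
    from DERIV_pos_inc_left[OF q[of b] this] ab
    obtain d where d: "0 < d" "\<And>h. 0 < h \<Longrightarrow> h < d \<Longrightarrow> q (b - h) < 0" by auto
    define h where "h = min d (b - a) / 2"
    have "0 < h" "h < d" "a < b - h" using d ab by (auto simp: h_def min_def field_simps)
    then have "0 < q (b - h)" using pos[of "b - h"] b(2) ab by force
    with d(2)[of h] \<open>0 < h\<close> \<open>h < d\<close> show False by simp
  qed
  with ab show ?thesis unfolding T_def \<omega>_def by blast
qed

section \<open>The Euler-Arnold frame\<close>

unbundle cross3_syntax

lemma inner_cross_rotate: "(a \<times> b) \<bullet> c = a \<bullet> (b \<times> c)"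
  by (metis cross_triple inner_commute)

lemma norm_cross3_le: "norm (a \<times> b) \<le> norm a * norm b"
  by (rule power2_le_imp_le) (simp_all add: power_mult_distrib norm_cross)

section \<open>Algebra of the connection and the curvature of a left-invariant metric\<close>

locale self_adjoint3 =
  fixes L :: "real^3 \<Rightarrow> real^3"
  assumes L_linear: "linear L"
    and L_self_adjoint: "\<And>a b. L a \<bullet> b = a \<bullet> L b"
begin

definition half_trace :: real where "half_trace = trace (matrix L) / 2"

text \<open>In an eigenbasis of \<open>L\<close> with eigenvalues \<lambda>1, \<lambda>2,
  \<lambda>3, the eigenvalues of \<open>K\<close> are Milnor's numbers (\<lambda>1 + \<lambda>2 +
  \<lambda>3) / 2 - \<lambda>i.\<close>

definition K :: "real^3 \<Rightarrow> real^3" where "K a = half_trace *\<^sub>R a - L a"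

lemmas L_simps = linear_add[OF L_linear] linear_diff[OF L_linear] linear_scale[OF L_linear]
  linear_0[OF L_linear] linear_neg[OF L_linear]

lemma L_bounded_linear: "bounded_linear L"
  using L_linear by (simp add: linear_conv_bounded_linear)

lemma K_bounded_linear: "bounded_linear K"
  unfolding K_def
  by (intro bounded_linear_sub bounded_linear_scaleR_right L_bounded_linear)

lemma K_linear: "linear K"
  using K_bounded_linear by (simp add: linear_conv_bounded_linear)

lemmas K_simps = linear_add[OF K_linear] linear_diff[OF K_linear] linear_scale[OF K_linear]
  linear_0[OF K_linear] linear_neg[OF K_linear]

lemma K_self_adjoint: "K a \<bullet> b = a \<bullet> K b"
  by (simp add: K_def inner_diff_left inner_diff_right L_self_adjoint)

text \<open>The infinitesimal form of M^T (M a \<times> M b) = det M (a \<times> b): differentiate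
  at the identity in the direction \<open>L\<close>; self-adjointness turns the transpose into
  \<open>L\<close>.\<close>

lemma L_cross: "L (a \<times> b) = (2 * half_trace) *\<^sub>R (a \<times> b) - L a \<times> b - a \<times> L b"
proof -
  define A where "A = matrix L"
  have L: "L x = A *v x" for x
    by (simp add: A_def matrix_works L_linear linear_def[symmetric])
  have "A $ i $ j = A $ j $ i" for i j
    using L_self_adjoint[of "axis j 1" "axis i 1"]
    by (simp add: L inner_axis inner_axis' matrix_vector_mult_basis column_def)
  then have s: "A $ 2 $ 1 = A $ 1 $ 2" "A $ 3 $ 1 = A $ 1 $ 3" "A $ 3 $ 2 = A $ 2 $ 3" by blast+
  show ?thesis
    unfolding half_trace_def A_def[symmetric] L
    by (simp add: vec_eq_iff forall_3 cross_components matrix_vector_mult_def trace_def sum_3 s algebra_simps)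
qed

text \<open>Milnor's form of the Koszul formula for \<open>[a, b] = L (a \<times> b)\<close>: the Levi-Civita connection is
  \<open>a \<mapsto> K a \<times> b\<close>.\<close>

lemma koszul_cross: "L (a \<times> b) - L a \<times> b + a \<times> L b = 2 *\<^sub>R (K a \<times> b)"
  unfolding L_cross K_def
  by (simp add: vec_eq_iff forall_3 cross_components algebra_simps)

text \<open>The curvature R(a, b) c of left-invariant fields with connection K a \<times> b and
  bracket L (a \<times> b). By the Jacobi identity the commutator of the cross multiplications by
  \<open>K a\<close> and \<open>K b\<close> is that by their cross product, so R(a, b) is itself a
  cross multiplication.\<close>

definition curv :: "real^3 \<Rightarrow> real^3 \<Rightarrow> real^3 \<Rightarrow> real^3" where
  "curv a b c = (K a \<times> K b - K (L (a \<times> b))) \<times> c"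

text \<open>Here \<open>h = y' + L (u \<times> y)\<close> is the variation of the Euler-Arnold velocity, and
  \<open>y' + K u \<times> y\<close> is the covariant derivative of \<open>y\<close>.\<close>

lemma covariant_eq_variation: "(h - L (u \<times> y)) + K u \<times> y = h + K y \<times> u"
proof -
  have "K u \<times> y - L (u \<times> y) = K y \<times> u"
    unfolding L_cross K_def
    by (simp add: vec_eq_iff forall_3 cross_components algebra_simps)
  then show ?thesis by (simp add: algebra_simps)
qed

text \<open>On the left is the second covariant derivative of \<open>y\<close> plus the curvature
  term, with h - L (u \<times> y) in place of y' and L u \<times> u in place of u'. All terms in
  \<open>y\<close> cancel: those with \<open>K\<close> applied to \<open>L\<close> against the
  bracket part of \<open>curv\<close>, the others by the Jacobi identity, since L u \<times> u = -
  (K u \<times> u). What remains is the Euler-Arnold equation linearized at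
  \<open>u\<close>.\<close>

lemma jacobi_eq_linearized:
  "h' + K (h - L (u \<times> y)) \<times> u + K y \<times> (L u \<times> u) + K u \<times> (h + K y \<times> u) + curv y u u
    = h' + h \<times> L u + u \<times> L h"
proof -
  have "K (h - L (u \<times> y)) \<times> u = K h \<times> u + K (L (y \<times> u)) \<times> u"
    by (subst cross_skew[of y u])
      (simp add: K_simps L_simps Cross3.left_diff_distrib)
  moreover have "K h \<times> u + K u \<times> h = h \<times> L u + u \<times> L h"
    unfolding K_def by (simp add: vec_eq_iff forall_3 cross_components algebra_simps)
  moreover have "K y \<times> (L u \<times> u) + K u \<times> (K y \<times> u) + (K y \<times> K u) \<times> u = 0"
    unfolding K_def[of u] by (simp add: vec_eq_iff forall_3 cross_components algebra_simps)
  ultimately show ?thesis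
    by (simp add: curv_def cross_add_right Cross3.left_diff_distrib algebra_simps)
qed

text \<open>The bracketed last summand is the derivative of K y \<bullet> (u \<times> y) when u' = L
  u \<times> u. Up to this exact term the integrand is free of curvature and depends on y' only
  through \<open>h\<close>.\<close>

lemma index_integrand_eq:
  assumes y': "y' = h - L (u \<times> y)"
  shows "(y' + K u \<times> y) \<bullet> (y' + K u \<times> y) - curv y u u \<bullet> y =
    h \<bullet> h + L u \<bullet> (h \<times> y) + (K y' \<bullet> (u \<times> y) + K y \<bullet> ((L u \<times> u) \<times> y + u \<times> y'))"
proof -
  define c where "c = u \<times> y"
  have y_u: "y \<times> u = - c" unfolding c_def by (rule cross_skew)
  have z: "y' + K u \<times> y = h + K y \<times> u" unfolding y' by (rule covariant_eq_variation)
  have Lc: "L c = (2 * half_trace) *\<^sub>R c - L u \<times> y - u \<times> L y" unfolding c_def by (rule L_cross)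
  have "curv y u u \<bullet> y = K (L c) \<bullet> c + (K y \<times> K u) \<bullet> c"
    unfolding curv_def inner_cross_rotate[of _ u y] c_def[symmetric] y_u
    by (simp add: L_simps K_simps inner_add_left)
  moreover have "K y' \<bullet> c = h \<bullet> K c - K (L c) \<bullet> c"
    by (simp add: y' c_def[symmetric] K_simps inner_diff_left K_self_adjoint)
  moreover have "K y \<bullet> (u \<times> y') = K y \<bullet> (u \<times> h) - K y \<bullet> (u \<times> L c)"
    by (simp add: y' c_def[symmetric] Cross3.right_diff_distrib inner_diff_right)
  moreover have "h \<bullet> K c = h \<bullet> (K y \<times> u) - h \<bullet> (y \<times> L u)"
  proof -
    have "K c = K y \<times> u - y \<times> L u"
      unfolding K_def Lc unfolding c_def
      by (simp add: vec_eq_iff forall_3 cross_components algebra_simps)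
    then show ?thesis by (simp add: inner_diff_right)
  qed
  moreover have "K y \<bullet> (u \<times> h) = h \<bullet> (K y \<times> u)" "L u \<bullet> (h \<times> y) = h \<bullet> (y \<times> L u)"
    by (simp_all add: inner_vec_def sum_3 cross_components algebra_simps)
  moreover have "(K y \<times> u) \<bullet> (K y \<times> u) - (K y \<times> K u) \<bullet> c = K y \<bullet> ((L u \<times> u) \<times> y) - K y \<bullet> (u \<times> L c)"
  proof -
    \<comment> \<open>Each term carries an outer factor \<open>K y\<close>, so the claim follows
      from a vector identity paired with \<open>k\<close>. \<open>L y\<close> is expressed by
      \<open>k\<close> so that \<open>y\<close> and \<open>k\<close> can be treated as independent
      vectors.\<close>
    define k where "k = K y"
    have Ly: "L y = half_trace *\<^sub>R y - k" by (simp add: k_def K_def)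
    have "u \<times> (k \<times> u) - K u \<times> c = (L u \<times> u) \<times> y - u \<times> L c"
      unfolding Lc Ly K_def unfolding c_def
      by (simp add: vec_eq_iff forall_3 cross_components algebra_simps)
    then have "k \<bullet> (u \<times> (k \<times> u)) - k \<bullet> (K u \<times> c) = k \<bullet> ((L u \<times> u) \<times> y) - k \<bullet> (u \<times> L c)"
      by (metis inner_diff_right)
    then show ?thesis by (simp add: inner_cross_rotate k_def)
  qed
  moreover have "(h + K y \<times> u) \<bullet> (h + K y \<times> u)
      = h \<bullet> h + 2 * (h \<bullet> (K y \<times> u)) + (K y \<times> u) \<bullet> (K y \<times> u)"
    by (simp add: inner_add_left inner_add_right inner_commute[of "K y \<times> u" h])
  ultimately show ?thesis
    unfolding z c_def[symmetric] inner_add_right[of "K y"] by linarith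
qed

end

section \<open>The moving frame along a nonsteady solution\<close>

locale euler_arnold_flow = self_adjoint3 +
  fixes u u' v w :: "real \<Rightarrow> real^3" and l :: real and \<delta> \<xi> :: "real \<Rightarrow> real"
  assumes u_deriv: "\<And>t. (u has_vector_derivative u' t) (at t)"
    and euler_arnold: "\<And>t. u' t = - (u t \<times> L (u t))"
    and nonsteady: "\<not> (\<exists>c. \<forall>t. u t = c)"
    and unit_speed: "\<And>t. u t \<bullet> u t = 1"
    and l_def: "l = u 0 \<bullet> L (u 0)"
    and \<delta>_def: "\<And>t. \<delta> t = (norm (u' t))\<^sup>2"
    and v_def: "\<And>t. v t = (1 / \<delta> t) *\<^sub>R u' t"
    and w_def: "\<And>t. w t = L (u t) - l *\<^sub>R u t"
    and \<xi>_def: "\<And>t. \<xi> t = (1 / (\<delta> t)\<^sup>2) *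
      ((u t \<times> L (u t)) \<bullet> (u t \<times> L (L (u t)) - L (u t \<times> L (u t))))"
begin

lemmas vector_derivatives = has_vector_derivative_add has_vector_derivative_diff
  has_vector_derivative_minus
  bounded_bilinear.has_vector_derivative[OF bilinear_cross[unfolded bilinear_conv_bounded_bilinear]]
  bounded_linear.has_vector_derivative[OF L_bounded_linear]
  bounded_linear.has_vector_derivative[OF K_bounded_linear]

lemma has_real_derivative_inner:
  assumes "(f has_vector_derivative f') (at t)" "(g has_vector_derivative g') (at t)"
  shows "((\<lambda>t. f t \<bullet> g t) has_real_derivative (f t \<bullet> g' + f' \<bullet> g t)) (at t)"
  unfolding has_real_derivative_iff_has_vector_derivative
  by (rule bounded_bilinear.has_vector_derivative[OF bounded_bilinear_inner assms])

lemma u'_eq: "u' t = L (u t) \<times> u t"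
  unfolding euler_arnold by (subst cross_skew) simp

lemma energy: "u t \<bullet> L (u t) = l"
proof -
  have "((\<lambda>t. u t \<bullet> L (u t)) has_real_derivative 0) (at t)" for t
  proof -
    have "u t \<bullet> L (u' t) + u' t \<bullet> L (u t) = 0"
      using L_self_adjoint[of "u t" "u' t"] by (simp add: u'_eq dot_cross_self inner_commute)
    then show ?thesis
      using has_real_derivative_inner[OF u_deriv vector_derivatives(5)[OF u_deriv], of t] by simp
  qed
  then have "u t \<bullet> L (u t) = u 0 \<bullet> L (u 0)"
    by (rule DERIV_isconst_all[where f="\<lambda>t. u t \<bullet> L (u t)", rule_format])
  then show ?thesis by (simp add: l_def)
qed

lemma Lu: "L (u t) = l *\<^sub>R u t + w t"
  by (simp add: w_def)

lemma w_u: "w t \<bullet> u t = 0"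
  using energy[of t] by (simp add: w_def inner_diff_left unit_speed inner_commute[of "L (u t)"])

lemma u'_u: "u' t \<bullet> u t = 0"
  by (simp add: euler_arnold dot_cross_self)

lemma w_cross_u: "w t \<times> u t = u' t"
  by (simp add: u'_eq w_def Cross3.left_diff_distrib cross_mult_left)

lemma u'_w: "u' t \<bullet> w t = 0"
  by (simp add: w_cross_u[symmetric] dot_cross_self)

lemma u_cross_u': "u t \<times> u' t = w t"
  unfolding w_cross_u[symmetric] Lagrange using w_u[of t] by (simp add: unit_speed inner_commute)

lemma \<delta>_u': "\<delta> t = u' t \<bullet> u' t"
  by (simp add: \<delta>_def power2_norm_eq_inner)

lemma \<delta>_w: "\<delta> t = w t \<bullet> w t"
  unfolding \<delta>_u' w_cross_u[symmetric] dot_cross using w_u[of t] by (simp add: unit_speed)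

lemma u'_cross_w: "u' t \<times> w t = \<delta> t *\<^sub>R u t"
  unfolding w_cross_u[symmetric]
  by (subst cross_skew) (use w_u[of t] in \<open>simp add: Lagrange \<delta>_w inner_commute\<close>)

lemma u''_deriv: "(u' has_vector_derivative L (u' t) \<times> u t + L (u t) \<times> u' t) (at t)"
proof -
  have "((\<lambda>t. L (u t) \<times> u t) has_vector_derivative L (u t) \<times> u' t + L (u' t) \<times> u t) (at t)"
    by (intro vector_derivatives u_deriv)
  then show ?thesis by (simp add: u'_eq[symmetric, abs_def] add.commute)
qed

text \<open>The derivative u' solves a linear homogeneous equation whose coefficients are bounded
  because \<open>u\<close> has unit length; a single zero would make it vanish identically and
  \<open>u\<close> constant.\<close>

lemma u'_nonzero: "u' t \<noteq> 0"
proof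
  assume "u' t = 0"
  obtain B where B: "0 \<le> B" "\<And>x. norm (L x) \<le> norm x * B"
    using bounded_linear.nonneg_bounded[OF L_bounded_linear] by blast
  have norm_u: "norm (u s) = 1" for s
    using unit_speed[of s] by (simp add: norm_eq_1)
  have "norm (L (u' s) \<times> u s + L (u s) \<times> u' s) \<le> (2 * B) * norm (u' s)" for s
  proof -
    have "norm (L (u' s) \<times> u s + L (u s) \<times> u' s) \<le> norm (L (u' s)) * norm (u s) + norm (L (u s)) * norm (u' s)"
      by (intro norm_triangle_le add_mono norm_cross3_le)
    also have "\<dots> \<le> norm (u' s) * B * 1 + 1 * B * norm (u' s)"
      using B(1) B(2)[of "u' s"] B(2)[of "u s"] by (intro add_mono mult_mono) (auto simp: norm_u)
    finally show ?thesis by simp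
  qed
  from vector_derivative_bound_imp_zero[OF u''_deriv this \<open>u' t = 0\<close>]
  have "u' s = 0" for s .
  then have "(u has_derivative (\<lambda>h. 0)) (at s)" for s
    using u_deriv[of s] by (simp add: has_vector_derivative_def)
  then have "\<exists>c. \<forall>s. u s = c"
    using has_derivative_zero_constant[of UNIV u] by auto
  with nonsteady show False by simp
qed

lemma \<delta>_pos: "0 < \<delta> t"
  using u'_nonzero by (simp add: \<delta>_def)

text \<open>Orthogonality to \<open>u\<close> and \<open>w\<close> makes the cross product of
  \<open>X\<close> with w \<times> u = u' vanish, so \<open>X\<close> is both parallel and
  orthogonal to the nonzero vector u'. Vector equations below are checked by three inner products in
  this way.\<close>

lemma frame_zero: "X \<bullet> u t = 0 \<Longrightarrow> X \<bullet> u' t = 0 \<Longrightarrow> X \<bullet> w t = 0 \<Longrightarrow> X = 0"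
proof -
  assume X: "X \<bullet> u t = 0" "X \<bullet> u' t = 0" "X \<bullet> w t = 0"
  then have "X \<times> u' t = 0"
    by (simp add: w_cross_u[symmetric] Lagrange)
  with X(2) show "X = 0" using norm_and_cross_eq_0[of X "u' t"] u'_nonzero by auto
qed

lemma v_inner: "v t \<bullet> u t = 0" "v t \<bullet> w t = 0" "v t \<bullet> v t = 1 / \<delta> t"
  using \<delta>_pos[of t] by (simp_all add: v_def u'_u u'_w \<delta>_u'[symmetric])

lemma u'_v: "u' t = \<delta> t *\<^sub>R v t"
  using \<delta>_pos[of t] by (simp add: v_def)

lemma frame_cross: "u t \<times> v t = (1 / \<delta> t) *\<^sub>R w t" "v t \<times> w t = u t" "w t \<times> u t = \<delta> t *\<^sub>R v t"
  using \<delta>_pos[of t] by (simp_all add: v_def cross_mult_right cross_mult_left u_cross_u' u'_cross_w w_cross_u)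

lemma w_deriv: "(w has_vector_derivative L (u' t) - l *\<^sub>R u' t) (at t)"
  unfolding w_def[abs_def]
  by (auto intro!: vector_derivatives u_deriv derivative_eq_intros)

lemma \<delta>_deriv: "(\<delta> has_real_derivative 2 * (w t \<bullet> L (u' t))) (at t)"
proof -
  have "((\<lambda>t. w t \<bullet> w t) has_real_derivative
      w t \<bullet> (L (u' t) - l *\<^sub>R u' t) + (L (u' t) - l *\<^sub>R u' t) \<bullet> w t) (at t)"
    by (intro has_real_derivative_inner w_deriv)
  moreover have "w t \<bullet> (L (u' t) - l *\<^sub>R u' t) + (L (u' t) - l *\<^sub>R u' t) \<bullet> w t = 2 * (w t \<bullet> L (u' t))"
    by (simp add: inner_diff_left inner_diff_right u'_w inner_commute)
  ultimately show ?thesis by (simp add: \<delta>_w[abs_def])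
qed

text \<open>The form in which \<xi> enters the computations: this combination of diagonal entries of
  \<open>L\<close> in the frame is what appears in the \<open>w\<close> component of u'' and in the
  derivative of y \<bullet> w.\<close>

lemma \<xi>_\<delta>: "\<xi> t * (\<delta> t)\<^sup>2 = L (w t) \<bullet> w t + l * \<delta> t - u' t \<bullet> L (u' t)"
proof -
  have "\<xi> t * (\<delta> t)\<^sup>2 = (u t \<times> L (u t)) \<bullet> (u t \<times> L (L (u t)) - L (u t \<times> L (u t)))"
    using \<delta>_pos[of t] by (simp add: \<xi>_def)
  also have "u t \<times> L (u t) = - u' t" by (simp add: euler_arnold)
  also have "(- u' t) \<bullet> (u t \<times> L (L (u t)) - L (- u' t)) = (u t \<times> u' t) \<bullet> L (L (u t)) - u' t \<bullet> L (u' t)"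
    by (subst cross_skew[of "u t" "u' t"]) (simp add: inner_add_right inner_cross_rotate L_simps)
  also have "(u t \<times> u' t) \<bullet> L (L (u t)) = L (w t) \<bullet> L (u t)"
    by (simp add: u_cross_u' L_self_adjoint)
  also have "\<dots> = L (w t) \<bullet> w t + l * \<delta> t"
    unfolding Lu[of t] inner_add_right
    by (simp add: L_self_adjoint Lu[of t] inner_add_right w_u \<delta>_w)
  finally show ?thesis .
qed

lemma v_deriv: "(v has_vector_derivative \<xi> t *\<^sub>R w t - (1 / \<delta> t) *\<^sub>R L (w t)) (at t)"
proof -
  define u2 where "u2 = L (u' t) \<times> u t + L (u t) \<times> u' t"
  define d where "d = w t \<bullet> L (u' t)"
  have u2_w: "u2 \<bullet> w t = l * \<delta> t - u' t \<bullet> L (u' t)"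
  proof -
    have "(L (u' t) \<times> u t) \<bullet> w t = - (u' t \<bullet> L (u' t))"
      unfolding inner_cross_rotate by (subst cross_skew) (simp add: w_cross_u inner_commute)
    moreover have "(L (u t) \<times> u' t) \<bullet> w t = l * \<delta> t"
      unfolding inner_cross_rotate u'_cross_w by (simp add: inner_commute energy)
    ultimately show ?thesis by (simp add: u2_def inner_add_left)
  qed
  have u2_u': "u2 \<bullet> u' t = d"
    unfolding u2_def inner_add_left inner_cross_rotate by (simp add: u_cross_u' d_def inner_commute)
  have u2_u: "u2 \<bullet> u t = - \<delta> t"
  proof -
    have "(L (u t) \<times> u' t) \<bullet> u t = - (u' t \<bullet> u' t)"
      by (subst cross_skew) (simp add: inner_cross_rotate u'_eq)
    then show ?thesis by (simp add: u2_def inner_add_left inner_cross_rotate \<delta>_u')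
  qed
  \<comment> \<open>The coefficient \<open>2 * d\<close> / \<delta> is \<delta>' / \<delta> and
    disappears when u' is divided by \<delta>. The components along \<open>u\<close> and u' hold
    without reference to \<xi>; the one along \<open>w\<close> is the identity for \<xi>
    \<delta>^2.\<close>
  have "u2 + L (w t) - (2 * d / \<delta> t) *\<^sub>R u' t - (\<xi> t * \<delta> t) *\<^sub>R w t = 0"
  proof (rule frame_zero)
    have "L (w t) \<bullet> u t = \<delta> t"
      by (simp add: L_self_adjoint Lu inner_add_right w_u \<delta>_w)
    then show "(u2 + L (w t) - (2 * d / \<delta> t) *\<^sub>R u' t - (\<xi> t * \<delta> t) *\<^sub>R w t) \<bullet> u t = 0"
      by (simp add: inner_add_left inner_diff_left u2_u u'_u w_u)
    show "(u2 + L (w t) - (2 * d / \<delta> t) *\<^sub>R u' t - (\<xi> t * \<delta> t) *\<^sub>R w t) \<bullet> u' t = 0"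
      using \<delta>_pos[of t] u'_w[of t]
      by (simp add: inner_add_left inner_diff_left u2_u' L_self_adjoint d_def \<delta>_u'[symmetric] inner_commute[of "w t" "u' t"])
    show "(u2 + L (w t) - (2 * d / \<delta> t) *\<^sub>R u' t - (\<xi> t * \<delta> t) *\<^sub>R w t) \<bullet> w t = 0"
      using \<xi>_\<delta>[of t]
      by (simp add: inner_add_left inner_diff_left u2_w u'_w \<delta>_w[symmetric] power2_eq_square)
  qed
  then have u2: "u2 = (2 * d / \<delta> t) *\<^sub>R u' t + (\<xi> t * \<delta> t) *\<^sub>R w t - L (w t)"
    by (simp add: algebra_simps)
  have "((\<lambda>t. (1 / \<delta> t) *\<^sub>R u' t) has_vector_derivative (1 / \<delta> t) *\<^sub>R u2 + (- (2 * d) / (\<delta> t)\<^sup>2) *\<^sub>R u' t) (at t)"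
    unfolding u2_def d_def
    by (rule has_vector_derivative_scaleR[OF _ u''_deriv])
      (use \<delta>_pos[of t] in \<open>auto intro!: derivative_eq_intros \<delta>_deriv simp: power2_eq_square\<close>)
  moreover have "(1 / \<delta> t) *\<^sub>R u2 + (- (2 * d) / (\<delta> t)\<^sup>2) *\<^sub>R u' t = \<xi> t *\<^sub>R w t - (1 / \<delta> t) *\<^sub>R L (w t)"
    using \<delta>_pos[of t] unfolding u2
    by (simp add: scaleR_add_right scaleR_diff_right power2_eq_square flip: scaleR_add_left)
  ultimately show ?thesis by (simp add: v_def[abs_def])
qed

end

section \<open>The index form and the linearized Euler-Arnold equation\<close>

text \<open>Integrability of \<open>F\<close> and \<open>G\<close> separately is avoided: either
  both have the same integral or neither is integrable, and then the default values agree.\<close>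

lemma integral_eq_of_diff_has_integral_zero:
  fixes F G :: "'a::euclidean_space \<Rightarrow> 'b::banach"
  assumes "((\<lambda>t. F t - G t) has_integral 0) S"
  shows "integral S F = integral S G"
proof -
  have "(F has_integral I) S \<longleftrightarrow> (G has_integral I) S" for I
    using has_integral_diff[OF _ assms, of F I] has_integral_add[OF _ assms, of G I] by auto
  then show ?thesis by (simp add: integral_def integrable_on_def)
qed

context euler_arnold_flow
begin

text \<open>The only terms outside the span with known coefficients are those with
  \<open>L (w t)\<close> and \<open>L (u' t)\<close>, coming from the derivatives of
  \<open>v\<close> and \<open>w\<close>; they are exactly cancelled by the bracket term.\<close>

lemma frame_variation:
  "p' *\<^sub>R u t + p *\<^sub>R u' t + (q' *\<^sub>R v t + q *\<^sub>R (\<xi> t *\<^sub>R w t - (1 / \<delta> t) *\<^sub>R L (w t)))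
      + (r' *\<^sub>R w t + r *\<^sub>R (L (u' t) - l *\<^sub>R u' t)) + L (u t \<times> (p *\<^sub>R u t + q *\<^sub>R v t + r *\<^sub>R w t))
    = p' *\<^sub>R u t + (q' + \<delta> t * (p - l * r)) *\<^sub>R v t + (r' + \<xi> t * q) *\<^sub>R w t"
proof -
  have "u t \<times> w t = - u' t" by (subst cross_skew) (simp add: w_cross_u)
  then have "u t \<times> (p *\<^sub>R u t + q *\<^sub>R v t + r *\<^sub>R w t) = (q / \<delta> t) *\<^sub>R w t - r *\<^sub>R u' t"
    by (simp add: cross_add_right cross_mult_right frame_cross)
  then have "L (u t \<times> (p *\<^sub>R u t + q *\<^sub>R v t + r *\<^sub>R w t)) = (q / \<delta> t) *\<^sub>R L (w t) - r *\<^sub>R L (u' t)"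
    by (simp only: L_simps)
  then show ?thesis
    by (simp only:) (simp add: u'_v algebra_simps)
qed

lemma frame_quadratic:
  fixes p q r h1 h2 h3 :: real and t
  defines "y \<equiv> p *\<^sub>R u t + q *\<^sub>R v t + r *\<^sub>R w t"
    and "h \<equiv> h1 *\<^sub>R u t + h2 *\<^sub>R v t + h3 *\<^sub>R w t"
  shows "h \<bullet> h + L (u t) \<bullet> (h \<times> y) =
    h1\<^sup>2 + h2\<^sup>2 / \<delta> t + \<delta> t * h3\<^sup>2 + l * (h2 * r - h3 * q) + h1 * q - h2 * p"
proof -
  have neg: "w t \<times> v t = - u t" "u t \<times> w t = - (\<delta> t *\<^sub>R v t)" "v t \<times> u t = - ((1 / \<delta> t) *\<^sub>R w t)"
    by (subst cross_skew, simp add: frame_cross)+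
  have "h \<times> y = (h2 * r - h3 * q) *\<^sub>R u t + ((h3 * p - h1 * r) * \<delta> t) *\<^sub>R v t + ((h1 * q - h2 * p) / \<delta> t) *\<^sub>R w t"
    unfolding h_def y_def
    by (simp add: cross_add_left cross_add_right cross_mult_left cross_mult_right frame_cross neg
        algebra_simps diff_divide_distrib)
  then have "L (u t) \<bullet> (h \<times> y) = l * (h2 * r - h3 * q) + (h1 * q - h2 * p)"
    using v_inner[of t] w_u[of t] \<delta>_pos[of t]
    by (simp add: Lu inner_add_left inner_add_right unit_speed \<delta>_w[symmetric] inner_commute)
  moreover have "h \<bullet> h = h1\<^sup>2 + h2\<^sup>2 / \<delta> t + \<delta> t * h3\<^sup>2"
    using v_inner[of t] w_u[of t] unfolding h_def
    by (simp add: inner_add_left inner_add_right unit_speed \<delta>_w[symmetric] inner_commute power2_eq_square)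
  ultimately show ?thesis by simp
qed

text \<open>The two integrands differ by the derivative of \<open>K y \<bullet> (u \<times> y) + p q - l r q\<close>.\<close>

lemma index_integral:
  fixes p q r :: "real \<Rightarrow> real"
  defines "y \<equiv> \<lambda>t. p t *\<^sub>R u t + q t *\<^sub>R v t + r t *\<^sub>R w t"
  assumes "0 < \<tau>"
    and C1: "p piecewise_C1_differentiable_on {0..\<tau>}" "q piecewise_C1_differentiable_on {0..\<tau>}"
      "r piecewise_C1_differentiable_on {0..\<tau>}"
    and zero: "p 0 = 0" "q 0 = 0" "r 0 = 0" "p \<tau> = 0" "q \<tau> = 0" "r \<tau> = 0"
  shows "integral {0..\<tau>} (\<lambda>t.
      (vector_derivative y (at t) + K (u t) \<times> y t) \<bullet> (vector_derivative y (at t) + K (u t) \<times> y t)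
        - curv (y t) (u t) (u t) \<bullet> y t) =
    integral {0..\<tau>} (\<lambda>t. (deriv p t)\<^sup>2 + \<delta> t * (deriv r t + \<xi> t * q t)\<^sup>2
         + (1 / \<delta> t) * (deriv q t)\<^sup>2 - l * \<xi> t * (q t)\<^sup>2)"
    (is "integral _ ?F = integral _ ?G")
proof -
  \<comment> \<open>At break points \<open>deriv\<close> has no controlled value. They are collected
    in a finite set, which the fundamental theorem of calculus below may ignore.\<close>
  have ex: "\<exists>S. finite S \<and> (\<forall>t\<in>{0..\<tau>} - S. (f has_real_derivative deriv f t) (at t))"
    if "f piecewise_C1_differentiable_on {0..\<tau>}" for f :: "real \<Rightarrow> real"
    using that unfolding piecewise_C1_differentiable_on_def C1_differentiable_on_def
    by (metis DERIV_imp_deriv has_real_derivative_iff_has_vector_derivative)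
  from ex[OF C1(1)] ex[OF C1(2)] ex[OF C1(3)] obtain S1 S2 S3 where
    "finite S1" "\<forall>t\<in>{0..\<tau>} - S1. (p has_real_derivative deriv p t) (at t)"
    "finite S2" "\<forall>t\<in>{0..\<tau>} - S2. (q has_real_derivative deriv q t) (at t)"
    "finite S3" "\<forall>t\<in>{0..\<tau>} - S3. (r has_real_derivative deriv r t) (at t)" by blast
  then obtain S where S: "finite S"
    "\<And>t. t \<in> {0..\<tau>} - S \<Longrightarrow> (p has_real_derivative deriv p t) (at t)"
    "\<And>t. t \<in> {0..\<tau>} - S \<Longrightarrow> (q has_real_derivative deriv q t) (at t)"
    "\<And>t. t \<in> {0..\<tau>} - S \<Longrightarrow> (r has_real_derivative deriv r t) (at t)"
    using that[of "S1 \<union> S2 \<union> S3"] by auto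
  define D where "D t = K (y t) \<bullet> (u t \<times> y t) + (p t * q t - l * r t * q t)" for t
  have D: "(D has_vector_derivative ?F t - ?G t) (at t)" if t: "t \<in> {0..\<tau>} - S" for t
  proof -
    let ?E = "deriv p t * q t + p t * deriv q t - l * (deriv r t * q t + r t * deriv q t)"
    define y' where "y' = deriv p t *\<^sub>R u t + p t *\<^sub>R u' t
      + (deriv q t *\<^sub>R v t + q t *\<^sub>R (\<xi> t *\<^sub>R w t - (1 / \<delta> t) *\<^sub>R L (w t)))
      + (deriv r t *\<^sub>R w t + r t *\<^sub>R (L (u' t) - l *\<^sub>R u' t))"
    define h1 h2 h3 where "h1 = deriv p t" and "h2 = deriv q t + \<delta> t * (p t - l * r t)"
      and "h3 = deriv r t + \<xi> t * q t"
    define h where "h = h1 *\<^sub>R u t + h2 *\<^sub>R v t + h3 *\<^sub>R w t"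
    have y: "(y has_vector_derivative y') (at t)"
    proof -
      have "(y has_vector_derivative p t *\<^sub>R u' t + deriv p t *\<^sub>R u t
        + (q t *\<^sub>R (\<xi> t *\<^sub>R w t - (1 / \<delta> t) *\<^sub>R L (w t)) + deriv q t *\<^sub>R v t)
        + (r t *\<^sub>R (L (u' t) - l *\<^sub>R u' t) + deriv r t *\<^sub>R w t)) (at t)"
        unfolding y_def
        by (intro has_vector_derivative_add has_vector_derivative_scaleR S t u_deriv v_deriv w_deriv)
      then show ?thesis by (simp add: y'_def add_ac)
    qed
    have h: "y' + L (u t \<times> y t) = h"
      unfolding y'_def y_def h_def h1_def h2_def h3_def by (rule frame_variation)
    then have y': "y' = h - L (u t \<times> y t)" by (simp add: algebra_simps)
    have d1: "((\<lambda>t. K (y t) \<bullet> (u t \<times> y t)) has_real_derivative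
        K (y t) \<bullet> (u t \<times> y' + u' t \<times> y t) + K y' \<bullet> (u t \<times> y t)) (at t)"
      by (intro has_real_derivative_inner vector_derivatives y u_deriv)
    have "(D has_real_derivative K y' \<bullet> (u t \<times> y t) + K (y t) \<bullet> (u' t \<times> y t + u t \<times> y')
        + (deriv p t * q t + p t * deriv q t - l * (deriv r t * q t + r t * deriv q t))) (at t)"
      unfolding D_def
      by (rule DERIV_cong, rule DERIV_add[OF d1])
        (auto intro!: derivative_eq_intros S t simp: algebra_simps)
    also have "K y' \<bullet> (u t \<times> y t) + K (y t) \<bullet> (u' t \<times> y t + u t \<times> y') + ?E = ?F t - ?G t"
    proof -
      have "?F t = h \<bullet> h + L (u t) \<bullet> (h \<times> y t)
        + (K y' \<bullet> (u t \<times> y t) + K (y t) \<bullet> (u' t \<times> y t + u t \<times> y'))"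
        unfolding vector_derivative_at[OF y] u'_eq by (rule index_integrand_eq[OF y'])
      \<comment> \<open>The summand h2 (l r - p) of the quadratic form turns h2^2 / \<delta> into
        q'^2 / \<delta> + q' (p - l r); with p' q and - l r' q this produces the exact term (p q - l
        r q)'.\<close>
      moreover have "h2\<^sup>2 / \<delta> t = (deriv q t)\<^sup>2 / \<delta> t + 2 * deriv q t * (p t - l * r t) + \<delta> t * (p t - l * r t)\<^sup>2"
        using \<delta>_pos[of t] by (simp add: h2_def field_simps power2_eq_square)
      then have "h \<bullet> h + L (u t) \<bullet> (h \<times> y t) = ?G t + ?E"
        unfolding h_def y_def frame_quadratic
        by (simp add: h1_def h2_def h3_def algebra_simps power2_eq_square)
      ultimately show ?thesis by linarith
    qed
    finally show ?thesis
      by (simp only: has_real_derivative_iff_has_vector_derivative)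
  qed
  have cont: "continuous_on {0..\<tau>} D"
  proof -
    have pqr: "continuous_on {0..\<tau>} p" "continuous_on {0..\<tau>} q" "continuous_on {0..\<tau>} r"
      using C1 by (simp_all add: piecewise_C1_differentiable_on_def)
    have "continuous_on {0..\<tau>} u" "continuous_on {0..\<tau>} v" "continuous_on {0..\<tau>} w"
      by (rule continuous_on_vector_derivative, rule has_vector_derivative_at_within,
          rule u_deriv v_deriv w_deriv)+
    with pqr have "continuous_on {0..\<tau>} y" unfolding y_def by (intro continuous_intros)
    with pqr \<open>continuous_on {0..\<tau>} u\<close> show ?thesis unfolding D_def
      by (intro continuous_intros continuous_on_cross bounded_linear.continuous_on[OF K_bounded_linear])
  qed
  have "((\<lambda>t. ?F t - ?G t) has_integral D \<tau> - D 0) {0..\<tau>}"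
    using S(1) \<open>0 < \<tau>\<close> D cont
    by (intro fundamental_theorem_of_calculus_interior_strong[of S]) auto
  moreover have "D \<tau> = 0" "D 0 = 0"
    by (simp_all add: D_def zero y_def K_simps)
  ultimately have FG: "((\<lambda>t. ?F t - ?G t) has_integral 0) {0..\<tau>}" by simp
  show ?thesis by (rule integral_eq_of_diff_has_integral_zero[OF FG])
qed

text \<open>The Jacobi equation as a first-order system: the first clause solves for the velocity
  variation \<open>h\<close>, the second is the derivative of the Euler-Arnold equation in the
  direction \<open>h\<close>. In this form global existence and uniqueness for linear equations
  apply.\<close>

definition linearized :: "(real \<Rightarrow> real^3) \<Rightarrow> (real \<Rightarrow> real^3) \<Rightarrow> bool" where
  "linearized y h \<longleftrightarrow> (\<forall>t. (y has_vector_derivative h t - L (u t \<times> y t)) (at t) \<and>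
     (h has_vector_derivative - (h t \<times> L (u t) + u t \<times> L (h t))) (at t))"

lemma linearized_deriv:
  assumes "linearized y h"
  shows "(y has_vector_derivative h t - L (u t \<times> y t)) (at t)"
    "(h has_vector_derivative - (h t \<times> L (u t) + u t \<times> L (h t))) (at t)"
  using assms by (simp_all add: linearized_def)

lemma linearized_field_bound:
  "\<exists>B. \<forall>t a b. norm (b - L (u t \<times> a), - (b \<times> L (u t) + u t \<times> L b)) \<le> B * norm (a, b)"
proof -
  obtain B where B: "0 \<le> B" "\<And>x. norm (L x) \<le> norm x * B"
    using bounded_linear.nonneg_bounded[OF L_bounded_linear] by blast
  have norm_u: "norm (u s) = 1" for s
    using unit_speed[of s] by (simp add: norm_eq_1)
  have "norm (b - L (u t \<times> a), - (b \<times> L (u t) + u t \<times> L b)) \<le> (1 + 3 * B) * norm (a, b)" for t a b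
  proof -
    have a: "norm a \<le> norm (a, b)" and b: "norm b \<le> norm (a, b)"
      by (rule norm_fst_le, rule norm_snd_le)
    have "norm (L (u t \<times> a)) \<le> norm a * B"
      using order_trans[OF B(2) mult_right_mono[OF norm_cross3_le B(1)], of "u t" a] by (simp add: norm_u)
    moreover have "norm (b \<times> L (u t)) \<le> norm b * B"
      using order_trans[OF norm_cross3_le mult_left_mono[OF B(2)], of b "u t"] by (simp add: norm_u)
    moreover have "norm (u t \<times> L b) \<le> norm b * B"
      using order_trans[OF norm_cross3_le mult_left_mono[OF B(2)], of "u t" b] by (simp add: norm_u)
    ultimately have "norm (b - L (u t \<times> a)) \<le> norm b + norm a * B"
      "norm (- (b \<times> L (u t) + u t \<times> L b)) \<le> norm b * B + norm b * B"
      using norm_triangle_ineq4[of b "L (u t \<times> a)"] norm_triangle_ineq[of "b \<times> L (u t)" "u t \<times> L b"]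
      unfolding norm_minus_cancel by linarith+
    then have "norm (b - L (u t \<times> a), - (b \<times> L (u t) + u t \<times> L b)) \<le> norm b + norm a * B + (norm b * B + norm b * B)"
      using norm_Pair_le by (metis (no_types, lifting) add_mono order_trans)
    also have "\<dots> \<le> norm (a, b) + norm (a, b) * B + (norm (a, b) * B + norm (a, b) * B)"
      using a b B(1) by (intro add_mono mult_right_mono)
    finally show ?thesis by (simp add: algebra_simps)
  qed
  then show ?thesis by blast
qed

lemma linearized_exists: "\<exists>y h. linearized y h \<and> y 0 = a \<and> h 0 = b"
proof -
  define A where "A t x = (snd x - L (u t \<times> fst x), - (snd x \<times> L (u t) + u t \<times> L (snd x)))"
    for t and x :: "(real^3, real^3) prod"
  obtain B where B: "\<And>t a b. norm (b - L (u t \<times> a), - (b \<times> L (u t) + u t \<times> L b)) \<le> B * norm (a, b)"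
    using linearized_field_bound by blast
  have u_cont: "continuous_on UNIV u"
    by (rule continuous_on_vector_derivative, rule has_vector_derivative_at_within, rule u_deriv)
  have "\<exists>x. x 0 = (a, b) \<and> (\<forall>t. (x has_vector_derivative A t (x t)) (at t))"
  proof (rule linear_ode_solution_exists)
    show "linear (A t)" for t
      by (rule linearI) (simp_all add: A_def L_simps cross_add_left cross_add_right
          cross_mult_left cross_mult_right scaleR_diff_right scaleR_add_right)
    show "norm (A t x) \<le> B * norm x" for t x
      using B[of "snd x" t "fst x"] by (simp add: A_def)
    show "continuous_on UNIV (\<lambda>t. A t (x t))" if "continuous_on UNIV x" for x
      unfolding A_def using that u_cont
      by (intro continuous_intros continuous_on_cross bounded_linear.continuous_on[OF L_bounded_linear])
  qed
  then obtain x where x: "x 0 = (a, b)" "\<And>t. (x has_vector_derivative A t (x t)) (at t)" by blast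
  have "linearized (\<lambda>t. fst (x t)) (\<lambda>t. snd (x t))"
    unfolding linearized_def
    using bounded_linear.has_vector_derivative[OF bounded_linear_fst x(2)]
      bounded_linear.has_vector_derivative[OF bounded_linear_snd x(2)]
    by (simp add: A_def)
  with x(1) show ?thesis by (intro exI[of _ "\<lambda>t. fst (x t)"] exI[of _ "\<lambda>t. snd (x t)"]) simp
qed

lemma linearized_zero:
  assumes "linearized y h" "y s = 0" "h s = 0"
  shows "y t = 0" "h t = 0"
proof -
  obtain B where B: "\<And>t a b. norm (b - L (u t \<times> a), - (b \<times> L (u t) + u t \<times> L b)) \<le> B * norm (a, b)"
    using linearized_field_bound by blast
  have d: "((\<lambda>t. (y t, h t)) has_vector_derivative
      (h t - L (u t \<times> y t), - (h t \<times> L (u t) + u t \<times> L (h t)))) (at t)" for t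
    by (intro has_vector_derivative_Pair linearized_deriv[OF assms(1)])
  have "(y t, h t) = 0"
    by (rule vector_derivative_bound_imp_zero[OF d B, where ?t0.0 = s]) (simp add: assms zero_prod_def)
  then show "y t = 0" "h t = 0" by (simp_all add: zero_prod_def)
qed

section \<open>Frame coordinates of a solution of the linearized system\<close>

definition coord_p :: "(real \<Rightarrow> real^3) \<Rightarrow> real \<Rightarrow> real" where "coord_p y t = y t \<bullet> u t"
text \<open>The coefficient of \<open>v\<close> is obtained by pairing with u' = \<delta> v, since
  \<open>v\<close> has squared length 1 / \<delta>; likewise w / \<delta> is dual to
  \<open>w\<close>.\<close>

definition coord_q :: "(real \<Rightarrow> real^3) \<Rightarrow> real \<Rightarrow> real" where "coord_q y t = y t \<bullet> u' t"
definition coord_r :: "(real \<Rightarrow> real^3) \<Rightarrow> real \<Rightarrow> real" where "coord_r y t = (y t \<bullet> w t) / \<delta> t"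

text \<open>This is q' / \<delta>, since h \<bullet> v = q' / \<delta> + p - l r. Written through
  \<open>y\<close> and \<open>h\<close>, it can be differentiated by the first-order
  equations.\<close>

definition slope :: "(real \<Rightarrow> real^3) \<Rightarrow> (real \<Rightarrow> real^3) \<Rightarrow> real \<Rightarrow> real" where
  "slope y h t = h t \<bullet> v t - coord_p y t + l * coord_r y t"

lemma frame_expansion: "y t = coord_p y t *\<^sub>R u t + coord_q y t *\<^sub>R v t + coord_r y t *\<^sub>R w t"
proof -
  have "y t - (coord_p y t *\<^sub>R u t + coord_q y t *\<^sub>R v t + coord_r y t *\<^sub>R w t) = 0"
  proof (rule frame_zero[where t=t])
  qed (use \<delta>_pos[of t] v_inner[of t] u'_u[of t] u'_w[of t] w_u[of t] in
      \<open>simp_all add: coord_p_def coord_q_def coord_r_def u'_v inner_diff_left inner_add_left unit_speed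
        \<delta>_w[symmetric] inner_commute[of "u t"] inner_commute[of "w t" "v t"]\<close>)
  then show ?thesis by simp
qed

context
  fixes y h
  assumes lin: "linearized y h"
begin

text \<open>Since \<open>h\<close> is a variation of \<open>u\<close>, this is the linearization of
  the conservation of u \<bullet> u / 2.\<close>

lemma h_u: "h t \<bullet> u t = h 0 \<bullet> u 0"
proof -
  have "((\<lambda>t. h t \<bullet> u t) has_real_derivative 0) (at t)" for t
  proof (rule DERIV_cong[OF has_real_derivative_inner[OF linearized_deriv(2)[OF lin] u_deriv]])
    show "h t \<bullet> u' t + - (h t \<times> L (u t) + u t \<times> L (h t)) \<bullet> u t = 0"
      by (simp add: inner_add_left inner_diff_left inner_cross_rotate[of "h t"] u'_eq dot_cross_self)
  qed
  then show ?thesis by (intro DERIV_isconst_all[where f="\<lambda>t. h t \<bullet> u t"]) blast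
qed

text \<open>The linearized conservation of u \<bullet> L u / 2 makes h \<bullet> L u constant;
  subtracting l (h \<bullet> u) gives the claim.\<close>

lemma h_w: "h t \<bullet> w t = h 0 \<bullet> w 0"
proof -
  have "((\<lambda>t. h t \<bullet> L (u t)) has_real_derivative 0) (at t)" for t
  proof (rule DERIV_cong[OF has_real_derivative_inner[OF linearized_deriv(2)[OF lin] vector_derivatives(5)[OF u_deriv]]])
    have "(u t \<times> L (h t)) \<bullet> L (u t) = h t \<bullet> L (u' t)"
      by (metis cross_triple inner_commute L_self_adjoint u'_eq)
    then show "h t \<bullet> L (u' t) + - (h t \<times> L (u t) + u t \<times> L (h t)) \<bullet> L (u t) = 0"
      by (simp add: inner_add_left inner_diff_left dot_cross_self)
  qed
  then have "h t \<bullet> L (u t) = h 0 \<bullet> L (u 0)"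
    by (intro DERIV_isconst_all[where f="\<lambda>t. h t \<bullet> L (u t)"]) blast
  then show ?thesis using h_u[of t] by (simp add: w_def inner_diff_right)
qed

lemma coord_p_deriv: "(coord_p y has_real_derivative h 0 \<bullet> u 0) (at t)"
  unfolding coord_p_def[abs_def]
proof (rule DERIV_cong[OF has_real_derivative_inner[OF linearized_deriv(1)[OF lin] u_deriv]])
  have "L (u t \<times> y t) \<bullet> u t = y t \<bullet> u' t"
    unfolding L_self_adjoint u'_eq by (metis cross_triple inner_commute)
  then show "y t \<bullet> u' t + (h t - L (u t \<times> y t)) \<bullet> u t = h 0 \<bullet> u 0"
    using h_u[of t] by (simp add: inner_diff_left)
qed

lemma coord_q_deriv: "(coord_q y has_real_derivative \<delta> t * slope y h t) (at t)"
  unfolding coord_q_def[abs_def]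
proof (rule DERIV_cong[OF has_real_derivative_inner[OF linearized_deriv(1)[OF lin] u''_deriv]])
  have "L (u t \<times> y t) \<bullet> u' t = y t \<bullet> (L (u' t) \<times> u t)"
    unfolding L_self_adjoint by (metis cross_triple inner_commute)
  moreover have "L (u t) \<times> u' t = l *\<^sub>R w t - \<delta> t *\<^sub>R u t"
    unfolding Lu cross_add_left
    by (subst cross_skew[of "w t"]) (simp add: cross_mult_left u_cross_u' u'_cross_w)
  ultimately have "y t \<bullet> (L (u' t) \<times> u t + L (u t) \<times> u' t) + (h t - L (u t \<times> y t)) \<bullet> u' t
      = h t \<bullet> u' t + l * (y t \<bullet> w t) - \<delta> t * (y t \<bullet> u t)"
    by (simp add: inner_add_right inner_diff_left inner_diff_right)
  then show "y t \<bullet> (L (u' t) \<times> u t + L (u t) \<times> u' t) + (h t - L (u t \<times> y t)) \<bullet> u' t = \<delta> t * slope y h t"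
    using \<delta>_pos[of t] by (simp add: slope_def coord_p_def coord_r_def u'_v algebra_simps)
qed

text \<open>Differentiating the denominator \<delta> cancels the terms 2 r (w \<bullet> L u') of the
  numerator; the remaining multiple of \<open>q\<close> is the combination that defines
  \<xi>.\<close>

lemma coord_r_deriv: "(coord_r y has_real_derivative (h 0 \<bullet> w 0) / \<delta> t - \<xi> t * coord_q y t) (at t)"
proof -
  define p q r where "p = coord_p y t" and "q = coord_q y t" and "r = coord_r y t"
  have y: "y t = p *\<^sub>R u t + q *\<^sub>R v t + r *\<^sub>R w t"
    unfolding p_def q_def r_def by (rule frame_expansion)
  have d: "((\<lambda>t. y t \<bullet> w t) has_real_derivative
      y t \<bullet> (L (u' t) - l *\<^sub>R u' t) + (h t - L (u t \<times> y t)) \<bullet> w t) (at t)"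
    by (intro has_real_derivative_inner linearized_deriv[OF lin] w_deriv)
  have "u t \<times> w t = - u' t" by (subst cross_skew) (simp add: w_cross_u)
  then have "u t \<times> y t = (q / \<delta> t) *\<^sub>R w t - r *\<^sub>R u' t"
    unfolding y by (simp add: cross_add_right cross_mult_right frame_cross)
  then have "L (u t \<times> y t) \<bullet> w t = (q / \<delta> t) * (L (w t) \<bullet> w t) - r * (w t \<bullet> L (u' t))"
    by (simp add: L_simps inner_diff_left inner_commute[of "L (u' t)"])
  moreover have "u t \<bullet> L (u' t) = 0"
    by (metis L_self_adjoint dot_cross_self(1) u'_eq)
  then have "y t \<bullet> L (u' t) = (q / \<delta> t) * (u' t \<bullet> L (u' t)) + r * (w t \<bullet> L (u' t))"
    unfolding y v_def by (simp add: inner_add_left)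
  moreover have "y t \<bullet> u' t = q" by (simp add: q_def coord_q_def)
  ultimately have "y t \<bullet> (L (u' t) - l *\<^sub>R u' t) + (h t - L (u t \<times> y t)) \<bullet> w t =
      h 0 \<bullet> w 0 + 2 * r * (w t \<bullet> L (u' t)) - (q / \<delta> t) * (L (w t) \<bullet> w t + l * \<delta> t - u' t \<bullet> L (u' t))"
    using \<delta>_pos[of t] h_w[of t]
    by (simp add: inner_diff_left inner_diff_right field_simps)
  also have "\<dots> = h 0 \<bullet> w 0 + 2 * r * (w t \<bullet> L (u' t)) - q * \<xi> t * \<delta> t"
    unfolding \<xi>_\<delta>[symmetric] using \<delta>_pos[of t] by (simp add: power2_eq_square)
  finally have d': "((\<lambda>t. y t \<bullet> w t) has_real_derivative
      h 0 \<bullet> w 0 + 2 * r * (w t \<bullet> L (u' t)) - q * \<xi> t * \<delta> t) (at t)"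
    using d by simp
  have r: "y t \<bullet> w t = r * \<delta> t" using \<delta>_pos[of t] by (simp add: r_def coord_r_def)
  show ?thesis
    unfolding coord_r_def[abs_def] q_def[symmetric]
    by (rule DERIV_cong[OF DERIV_divide[OF d' \<delta>_deriv]])
      (use \<delta>_pos[of t] in \<open>simp_all add: r field_simps power2_eq_square\<close>)
qed

text \<open>The two occurrences of (h \<bullet> L w) / \<delta>, from v' and from h', cancel. The
  constants h \<bullet> u and l (h \<bullet> w) / \<delta> cancel against p' and l r', so only \<xi>
  terms survive.\<close>

lemma slope_deriv: "(slope y h has_real_derivative \<xi> t * (h 0 \<bullet> w 0 - l * coord_q y t)) (at t)"
proof -
  have d: "((\<lambda>t. h t \<bullet> v t - coord_p y t + l * coord_r y t) has_real_derivative
      h t \<bullet> (\<xi> t *\<^sub>R w t - (1 / \<delta> t) *\<^sub>R L (w t)) + - (h t \<times> L (u t) + u t \<times> L (h t)) \<bullet> v t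
        - h 0 \<bullet> u 0 + l * ((h 0 \<bullet> w 0) / \<delta> t - \<xi> t * coord_q y t)) (at t)"
    by (intro DERIV_add DERIV_diff DERIV_cmult has_real_derivative_inner linearized_deriv[OF lin]
        v_deriv coord_p_deriv coord_r_deriv)
  have "w t \<times> v t = - u t" "v t \<times> u t = - ((1 / \<delta> t) *\<^sub>R w t)"
    by (subst cross_skew, simp add: frame_cross)+
  then have "(h t \<times> L (u t)) \<bullet> v t = l * (h t \<bullet> w t) / \<delta> t - h t \<bullet> u t"
    unfolding inner_cross_rotate Lu
    by (simp add: cross_add_left cross_mult_left frame_cross inner_diff_right)
  moreover have "(u t \<times> L (h t)) \<bullet> v t = L (h t) \<bullet> (v t \<times> u t)"
    by (metis cross_triple inner_commute)
  then have "(u t \<times> L (h t)) \<bullet> v t = - ((h t \<bullet> L (w t)) / \<delta> t)"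
    unfolding \<open>v t \<times> u t = _\<close> by (simp add: L_self_adjoint)
  ultimately show ?thesis
    unfolding slope_def[abs_def]
    by (intro DERIV_cong[OF d])
      (simp add: inner_diff_right inner_add_left h_u[of t] h_w[of t] algebra_simps)
qed

end

section \<open>Absence and existence of conjugate points\<close>

lemma initial_slope:
  assumes "y t = 0" shows "slope y h t = h t \<bullet> v t"
  using assms by (simp add: slope_def coord_p_def coord_r_def)

lemma coords_zero_iff:
  "y t = 0 \<longleftrightarrow> coord_p y t = 0 \<and> coord_q y t = 0 \<and> coord_r y t = 0"
  using frame_expansion[of y t] by (auto simp: coord_p_def coord_q_def coord_r_def)

text \<open>The function \<open>E\<close> below is the integral of the index form up to time \<open>t\<close>.\<close>

lemma no_conjugate:
  assumes lin: "linearized y h" and "y 0 = 0" "y s = 0" "0 < s"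
    and "0 \<le> l" and \<xi>: "\<And>t. 0 \<le> t \<Longrightarrow> \<xi> t \<le> 0"
  shows "y t = 0"
proof -
  define a c where "a = h 0 \<bullet> u 0" and "c = h 0 \<bullet> w 0"
  define E where "E t = a * coord_p y t + c * coord_r y t + coord_q y t * slope y h t" for t
  define E' where "E' t = a\<^sup>2 + c\<^sup>2 / \<delta> t + \<delta> t * (slope y h t)\<^sup>2 - l * \<xi> t * (coord_q y t)\<^sup>2" for t
  have E: "(E has_real_derivative E' t) (at t)" for t
    unfolding E_def[abs_def]
    by (rule DERIV_cong, rule DERIV_add[OF DERIV_add[OF DERIV_cmult DERIV_cmult] DERIV_mult],
        rule coord_p_deriv[OF lin], rule coord_r_deriv[OF lin], rule coord_q_deriv[OF lin],
        rule slope_deriv[OF lin])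
      (simp add: E'_def a_def[symmetric] c_def[symmetric] algebra_simps power2_eq_square)
  \<comment> \<open>The conditions on \<open>l\<close> and \<xi> are used here: they give the last
    summand of \<open>E'\<close> the same sign as the squares.\<close>
  have E'_nonneg: "0 \<le> E' t" if "0 \<le> t" for t
  proof -
    have "l * \<xi> t * (coord_q y t)\<^sup>2 \<le> 0"
      using \<open>0 \<le> l\<close> \<xi>[OF that] by (simp add: mult_nonneg_nonpos mult_nonpos_nonneg)
    then show ?thesis using \<delta>_pos[of t] unfolding E'_def
      by (smt (verit) divide_nonneg_pos mult_nonneg_nonneg zero_le_power2)
  qed
  have E_le: "E t \<le> 0" if "0 \<le> t" "t \<le> s" for t
  proof -
    have "E t \<le> E s"
      by (rule DERIV_nonneg_imp_nondecreasing[OF \<open>t \<le> s\<close>]) (use E E'_nonneg that in force)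
    then show ?thesis using \<open>y s = 0\<close> coords_zero_iff[of y s] by (simp add: E_def)
  qed
  \<comment> \<open>As \<open>E\<close> vanishes at 0 and is nonpositive up to \<open>s\<close>, its
    derivative at 0 is not positive. There \<open>q\<close> vanishes and \<open>E'\<close> is a
    positive definite form in the three components of \<open>h 0\<close>, which forces
    \<open>h 0 = 0\<close>.\<close>
  have zero: "coord_p y 0 = 0" "coord_q y 0 = 0" "coord_r y 0 = 0"
    using \<open>y 0 = 0\<close> coords_zero_iff by auto
  have "\<not> 0 < E' 0"
  proof
    assume "0 < E' 0"
    from DERIV_pos_inc_right[OF E this] obtain d where
      d: "0 < d" "\<And>k. 0 < k \<Longrightarrow> k < d \<Longrightarrow> E 0 < E (0 + k)" by blast
    have "E 0 < E (min d s / 2)"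
      using d(2)[of "min d s / 2"] d(1) \<open>0 < s\<close> by simp
    moreover have "E (min d s / 2) \<le> 0" using d(1) \<open>0 < s\<close> by (intro E_le) auto
    moreover have "E 0 = 0" using zero by (simp add: E_def)
    ultimately show False by simp
  qed
  then have "a\<^sup>2 + c\<^sup>2 / \<delta> 0 + \<delta> 0 * (slope y h 0)\<^sup>2 \<le> 0"
    using zero by (simp add: E'_def)
  moreover have "0 \<le> a\<^sup>2" "0 \<le> c\<^sup>2 / \<delta> 0" "0 \<le> \<delta> 0 * (slope y h 0)\<^sup>2"
    using \<delta>_pos[of 0] by simp_all
  ultimately have "a\<^sup>2 = 0" "c\<^sup>2 / \<delta> 0 = 0" "\<delta> 0 * (slope y h 0)\<^sup>2 = 0" by linarith+
  then have "a = 0" "c = 0" "h 0 \<bullet> v 0 = 0"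
    using \<delta>_pos[of 0] initial_slope[of y 0 h] \<open>y 0 = 0\<close> by simp_all
  then have "h 0 = 0"
    by (intro frame_zero[of "h 0" 0]) (simp_all add: a_def c_def u'_v)
  then show ?thesis using linearized_zero(1)[OF lin \<open>y 0 = 0\<close>] by simp
qed

lemma linearized_combination:
  assumes "linearized y1 h1" "linearized y2 h2"
  shows "linearized (\<lambda>t. a *\<^sub>R y1 t + b *\<^sub>R y2 t) (\<lambda>t. a *\<^sub>R h1 t + b *\<^sub>R h2 t)"
  unfolding linearized_def
proof (intro allI conjI)
  fix t
  have "((\<lambda>t. a *\<^sub>R y1 t + b *\<^sub>R y2 t) has_vector_derivative
      a *\<^sub>R (h1 t - L (u t \<times> y1 t)) + b *\<^sub>R (h2 t - L (u t \<times> y2 t))) (at t)"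
    by (intro has_vector_derivative_add bounded_linear.has_vector_derivative[OF bounded_linear_scaleR_right]
        linearized_deriv[OF assms(1)] linearized_deriv[OF assms(2)])
  then show "((\<lambda>t. a *\<^sub>R y1 t + b *\<^sub>R y2 t) has_vector_derivative
      (a *\<^sub>R h1 t + b *\<^sub>R h2 t) - L (u t \<times> (a *\<^sub>R y1 t + b *\<^sub>R y2 t))) (at t)"
    by (simp add: L_simps cross_add_right cross_mult_right algebra_simps)
  have "((\<lambda>t. a *\<^sub>R h1 t + b *\<^sub>R h2 t) has_vector_derivative
      a *\<^sub>R (- (h1 t \<times> L (u t) + u t \<times> L (h1 t))) + b *\<^sub>R (- (h2 t \<times> L (u t) + u t \<times> L (h2 t)))) (at t)"
    by (intro has_vector_derivative_add bounded_linear.has_vector_derivative[OF bounded_linear_scaleR_right]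
        linearized_deriv[OF assms(1)] linearized_deriv[OF assms(2)])
  then show "((\<lambda>t. a *\<^sub>R h1 t + b *\<^sub>R h2 t) has_vector_derivative
      - ((a *\<^sub>R h1 t + b *\<^sub>R h2 t) \<times> L (u t) + u t \<times> L (a *\<^sub>R h1 t + b *\<^sub>R h2 t))) (at t)"
    by (simp add: L_simps cross_add_left cross_add_right cross_mult_left cross_mult_right algebra_simps)
qed

text \<open>With h \<bullet> u = 0 the coordinate \<open>p\<close> stays zero, and two conditions
  \<open>q = r = 0\<close> remain for a two-dimensional family of solutions vanishing at 0;
  \<open>D\<close> is the determinant of these conditions.\<close>

lemma conjugate_exists:
  assumes "0 < l" "0 < \<delta>0" "0 < \<xi>0"
    and \<delta>0: "\<And>t. 0 \<le> t \<Longrightarrow> \<delta>0 \<le> \<delta> t" and \<xi>0: "\<And>t. 0 \<le> t \<Longrightarrow> \<xi>0 \<le> \<xi> t"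
  shows "\<exists>s y h. 0 < s \<and> s \<le> 2 * pi / sqrt (l * \<xi>0 * \<delta>0) \<and> linearized y h \<and> y 0 = 0 \<and> y s = 0 \<and> h 0 \<noteq> 0"
proof -
  \<comment> \<open>Since u' \<bullet> v = 1 and w \<bullet> w = \<delta>, these initial vectors
    give (slope, h \<bullet> w) the values (1, 0) and (0, 1).\<close>
  obtain y1 h1 where 1: "linearized y1 h1" "y1 0 = 0" "h1 0 = u' 0"
    using linearized_exists by blast
  obtain y2 h2 where 2: "linearized y2 h2" "y2 0 = 0" "h2 0 = (1 / \<delta> 0) *\<^sub>R w 0"
    using linearized_exists by blast
  define q1 r1 s1 where "q1 = coord_q y1" and "r1 = coord_r y1" and "s1 = slope y1 h1"
  define q2 r2 s2 where "q2 = coord_q y2" and "r2 = coord_r y2" and "s2 = slope y2 h2"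
  have c1: "h1 0 \<bullet> u 0 = 0" "h1 0 \<bullet> w 0 = 0" by (simp_all add: 1 u'_u u'_w)
  have c2: "h2 0 \<bullet> u 0 = 0" "h2 0 \<bullet> w 0 = 1"
    using \<delta>_pos[of 0] by (simp_all add: 2 w_u \<delta>_w[symmetric])
  have init: "q1 0 = 0" "r1 0 = 0" "s1 0 = 1" "q2 0 = 0" "r2 0 = 0" "s2 0 = 0"
    using \<delta>_pos[of 0] v_inner(2,3)[of 0]
    by (simp_all add: q1_def r1_def s1_def q2_def r2_def s2_def coord_q_def coord_r_def initial_slope 1 2 u'_v
        inner_commute)
  have d1: "(q1 has_real_derivative \<delta> t * s1 t) (at t)" "(r1 has_real_derivative - (\<xi> t * q1 t)) (at t)"
      "(s1 has_real_derivative - (l * \<xi> t * q1 t)) (at t)" for t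
    using coord_q_deriv[OF 1(1), of t] coord_r_deriv[OF 1(1), of t] slope_deriv[OF 1(1), of t]
    by (simp_all add: q1_def r1_def s1_def c1 mult_ac)
  have d2: "(q2 has_real_derivative \<delta> t * s2 t) (at t)" "(r2 has_real_derivative 1 / \<delta> t - \<xi> t * q2 t) (at t)"
      "(s2 has_real_derivative \<xi> t * (1 - l * q2 t)) (at t)" for t
    using coord_q_deriv[OF 2(1), of t] coord_r_deriv[OF 2(1), of t] slope_deriv[OF 2(1), of t]
    by (simp_all add: q2_def r2_def s2_def c2)
  have p1: "coord_p y1 t = 0" for t
  proof -
    have "coord_p y1 t = coord_p y1 0"
      using coord_p_deriv[OF 1(1)] by (intro DERIV_isconst_all) (simp add: c1)
    then show ?thesis by (simp add: coord_p_def 1)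
  qed
  have p2: "coord_p y2 t = 0" for t
  proof -
    have "coord_p y2 t = coord_p y2 0"
      using coord_p_deriv[OF 2(1)] by (intro DERIV_isconst_all) (simp add: c2)
    then show ?thesis by (simp add: coord_p_def 2)
  qed
  have r1: "l * r1 t = s1 t - 1" for t
  proof -
    have "((\<lambda>t. s1 t - l * r1 t) has_real_derivative 0) (at t)" for t
      by (rule DERIV_cong[OF DERIV_diff[OF d1(3) DERIV_cmult[OF d1(2)]]]) simp
    then have "s1 t - l * r1 t = s1 0 - l * r1 0"
      by (intro DERIV_isconst_all[where f="\<lambda>t. s1 t - l * r1 t"]) blast
    then show ?thesis by (simp add: init)
  qed
  \<comment> \<open>The pair (1 - l q2, - l s2) solves the same homogeneous system as (q1, s1); this
    is the Wronskian of the two, equal to 1 at time 0.\<close>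
  have wronskian: "(1 - l * q2 t) * s1 t + l * q1 t * s2 t = 1" for t
  proof -
    have "((\<lambda>t. (1 - l * q2 t) * s1 t + l * q1 t * s2 t) has_real_derivative 0) (at t)" for t
      by (rule derivative_eq_intros d1 d2 refl)+ (simp add: algebra_simps)
    then have "(1 - l * q2 t) * s1 t + l * q1 t * s2 t = (1 - l * q2 0) * s1 0 + l * q1 0 * s2 0"
      by (intro DERIV_isconst_all[where f="\<lambda>t. (1 - l * q2 t) * s1 t + l * q1 t * s2 t"]) blast
    then show ?thesis by (simp add: init)
  qed
  define T where "T = pi / sqrt (\<delta>0 * (l * \<xi>0))"
  have l\<xi>: "l * \<xi>0 \<le> l * \<xi> t" if "0 \<le> t" for t
    using \<xi>0[OF that] \<open>0 < l\<close> by simp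
  obtain a where a: "0 < a" "a \<le> T" "q1 a = 0" "s1 a \<le> 0"
    using half_turn[where a=0 and q=q1 and s=s1 and f=\<delta> and g="\<lambda>t. l * \<xi> t" and ?f0.0=\<delta>0 and ?g0.0="l * \<xi>0"]
      d1 init \<delta>0 l\<xi> assms(1-3) unfolding T_def by auto
  \<comment> \<open>The strict sign allows the half-turn lemma to be applied again, from
    \<open>a\<close> on, to (- q1, - s1).\<close>
  have "s1 a \<noteq> 0" using wronskian[of a] a by auto
  with a have sa: "s1 a < 0" by simp
  have "\<exists>b. a < b \<and> b \<le> a + T \<and> - q1 b = 0 \<and> - s1 b \<le> 0"
    unfolding T_def
  proof (rule half_turn[where f=\<delta> and g="\<lambda>t. l * \<xi> t"])
    show "((\<lambda>t. - q1 t) has_real_derivative \<delta> t * - s1 t) (at t)" for t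
      using DERIV_minus[OF d1(1)] by simp
    show "((\<lambda>t. - s1 t) has_real_derivative - (l * \<xi> t * - q1 t)) (at t)" for t
      using DERIV_minus[OF d1(3)] by simp
  qed (use a sa \<delta>0 l\<xi> assms(1-3) in auto)
  then obtain b where b: "a < b" "b \<le> a + T" "q1 b = 0" "0 \<le> s1 b" by auto
  define D where "D t = q1 t * r2 t - q2 t * r1 t" for t
  \<comment> \<open>Where \<open>q1\<close> vanishes, \<open>D = - q2 * r1\<close>, and the
    Wronskian gives \<open>l * q2 * s1 = s1 - 1\<close>, while \<open>l * r1 = s1 - 1\<close>
    always.\<close>
  have D: "D t * (l\<^sup>2 * s1 t) = - (s1 t - 1)\<^sup>2" if "q1 t = 0" for t
  proof -
    have *: "(l * q2 t) * s1 t = s1 t - 1"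
      using wronskian[of t] that by (simp add: algebra_simps)
    have "- ((l * q2 t) * s1 t) * (l * r1 t) = - (s1 t - 1)\<^sup>2"
      unfolding * r1 by (simp add: power2_eq_square algebra_simps)
    then show ?thesis by (simp add: D_def that power2_eq_square mult_ac)
  qed
  have "0 \<le> D a"
  proof (rule ccontr)
    assume "\<not> 0 \<le> D a"
    then have "0 < D a * (l\<^sup>2 * s1 a)"
      using sa \<open>0 < l\<close> by (intro mult_neg_neg) (auto simp: mult_pos_neg)
    then show False using D[OF a(3)] by simp
  qed
  \<comment> \<open>A positive \<open>D b\<close> would make the left side of the identity
    nonnegative and its right side a negated square, so \<open>s1 b = 1\<close>; then the Wronskian
    gives \<open>q2 b = 0\<close>, and \<open>D b = 0\<close> after all.\<close>
  moreover have "D b \<le> 0"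
  proof (rule ccontr)
    assume "\<not> D b \<le> 0"
    then have "0 \<le> D b * (l\<^sup>2 * s1 b)" using b by simp
    then have "s1 b = 1" using D[OF b(3)] by simp
    then have "q2 b = 0" using wronskian[of b] b \<open>0 < l\<close> by simp
    then show False using \<open>\<not> D b \<le> 0\<close> b by (simp add: D_def)
  qed
  moreover have "continuous_on {a..b} D"
    unfolding D_def
    by (intro continuous_intros; rule DERIV_continuous_on, rule has_field_derivative_at_within, rule d1 d2)
  ultimately obtain s where s: "a \<le> s" "s \<le> b" "D s = 0"
    using IVT2'[of D b 0 a] b by auto
  have "\<exists>\<alpha> \<beta>. (\<alpha>, \<beta>) \<noteq> (0, 0) \<and> \<alpha> * q1 s + \<beta> * q2 s = 0 \<and> \<alpha> * r1 s + \<beta> * r2 s = 0"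
  proof (cases "q1 s = 0 \<and> q2 s = 0")
    case True
    show ?thesis
    proof (cases "r1 s = 0 \<and> r2 s = 0")
      case False then show ?thesis using True by (intro exI[of _ "r2 s"] exI[of _ "- r1 s"]) auto
    qed (use True in auto)
  next
    case False
    then show ?thesis using s(3)
      by (intro exI[of _ "q2 s"] exI[of _ "- q1 s"]) (auto simp: D_def)
  qed
  then obtain \<alpha> \<beta> where ab: "(\<alpha>, \<beta>) \<noteq> (0, 0)"
    "\<alpha> * q1 s + \<beta> * q2 s = 0" "\<alpha> * r1 s + \<beta> * r2 s = 0" by blast
  define y h where "y = (\<lambda>t. \<alpha> *\<^sub>R y1 t + \<beta> *\<^sub>R y2 t)" and "h = (\<lambda>t. \<alpha> *\<^sub>R h1 t + \<beta> *\<^sub>R h2 t)"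
  have "linearized y h" unfolding y_def h_def by (rule linearized_combination[OF 1(1) 2(1)])
  moreover have "y 0 = 0" by (simp add: y_def 1 2)
  moreover have "y s = 0"
    unfolding coords_zero_iff
    using ab(2,3) p1[of s] p2[of s] \<delta>_pos[of s]
    by (simp add: y_def coord_p_def coord_q_def coord_r_def q1_def q2_def r1_def r2_def inner_add_left
        add_divide_distrib)
  moreover have "h 0 \<noteq> 0"
  proof
    assume "h 0 = 0"
    then have "h 0 \<bullet> w 0 = 0" "h 0 \<bullet> u' 0 = 0" by simp_all
    then show False
      using ab(1) \<delta>_pos[of 0] u'_w[of 0]
      by (simp add: h_def 1 2 inner_add_left \<delta>_w[symmetric] \<delta>_u'[symmetric] inner_commute[of "w 0" "u' 0"])
  qed
  moreover have "0 < s" "s \<le> 2 * pi / sqrt (l * \<xi>0 * \<delta>0)"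
    using s a b by (simp_all add: T_def mult_ac)
  ultimately show ?thesis by blast
qed

end

section \<open>Smooth maps\<close>

lemma Ck_on_imp_continuous_on: "Ck_on k S f \<Longrightarrow> continuous_on S f"
  by (cases k)
    (auto simp: continuous_at_imp_continuous_on differentiable_imp_continuous_within)

lemma Ck_on_Suc_imp: "Ck_on (Suc k) S f \<Longrightarrow> Ck_on k S f"
proof (induction k arbitrary: f)
  case 0 then show ?case using Ck_on_imp_continuous_on[OF 0] by simp
next
  case (Suc k)
  have "Ck_on (Suc k) S (\<lambda>x. frechet_derivative f (at x) h)" for h
    using Suc.prems by (metis Ck_on.simps(2))
  then have "Ck_on k S (\<lambda>x. frechet_derivative f (at x) h)" for h
    by (rule Suc.IH)
  then show ?case using Suc.prems by (metis Ck_on.simps(2))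
qed

lemma Ck_on_subset: "Ck_on k S f \<Longrightarrow> T \<subseteq> S \<Longrightarrow> Ck_on k T f"
  by (induction k arbitrary: f) (auto intro: continuous_on_subset)

lemma frechet_derivative_cong_open:
  assumes "open S" "x \<in> S" "\<And>y. y \<in> S \<Longrightarrow> f y = g y" "f differentiable (at x)"
  shows "g differentiable (at x)" "frechet_derivative g (at x) = frechet_derivative f (at x)"
proof -
  have "(f has_derivative frechet_derivative f (at x)) (at x)"
    using assms(4) by (simp add: frechet_derivative_works)
  then have "(g has_derivative frechet_derivative f (at x)) (at x)"
    by (rule has_derivative_transform_within_open[OF _ assms(1,2)]) (use assms(3) in auto)
  then show "g differentiable (at x)" "frechet_derivative g (at x) = frechet_derivative f (at x)"
    by (auto simp: differentiable_def intro: frechet_derivative_at[symmetric])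
qed

lemma Ck_on_cong:
  assumes "open S" "\<And>x. x \<in> S \<Longrightarrow> f x = g x" "Ck_on k S f"
  shows "Ck_on k S g"
  using assms(2,3)
proof (induction k arbitrary: f g)
  case 0 then show ?case by (auto cong: continuous_on_cong)
next
  case (Suc k)
  have "g differentiable (at x) \<and> frechet_derivative g (at x) = frechet_derivative f (at x)" if "x \<in> S" for x
    using frechet_derivative_cong_open[OF assms(1) that Suc.prems(1)] Suc.prems(2) that by simp
  moreover have "Ck_on k S (\<lambda>x. frechet_derivative g (at x) h)" for h
    by (rule Suc.IH[of "\<lambda>x. frechet_derivative f (at x) h"]) (use Suc.prems calculation in auto)
  ultimately show ?case by simp
qed

lemma Ck_on_local:
  assumes "\<And>x. x \<in> S \<Longrightarrow> \<exists>T. open T \<and> x \<in> T \<and> Ck_on k T f"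
  shows "Ck_on k S f"
  using assms
proof (induction k arbitrary: f)
  case 0
  have "isCont f x" if "x \<in> S" for x
    using 0[OF that] by (auto simp: continuous_on_eq_continuous_at)
  then show ?case by (simp add: continuous_at_imp_continuous_on)
next
  case (Suc k)
  have "Ck_on k S (\<lambda>x. frechet_derivative f (at x) h)" for h
    by (rule Suc.IH) (use Suc.prems in \<open>fastforce\<close>)
  moreover have "f differentiable (at x)" if "x \<in> S" for x
    using Suc.prems[OF that] by auto
  ultimately show ?case by simp
qed

text \<open>The introduction rule for the closure lemmas below: on an open set the chosen
  \<open>frechet_derivative\<close> may be replaced by any explicit derivative.\<close>

lemma Ck_on_has_derivative:
  assumes "open S" "\<And>x. x \<in> S \<Longrightarrow> (f has_derivative f' x) (at x)" "\<And>h. Ck_on k S (\<lambda>x. f' x h)"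
  shows "Ck_on (Suc k) S f"
proof -
  have *: "frechet_derivative f (at x) = f' x" if "x \<in> S" for x
    using frechet_derivative_at[OF assms(2)[OF that]] by simp
  have "Ck_on k S (\<lambda>x. frechet_derivative f (at x) h)" for h
    by (rule Ck_on_cong[OF assms(1) _ assms(3)[of h]]) (simp add: *)
  then show ?thesis using assms(2) by (auto simp: differentiable_def)
qed

lemma Ck_on_Suc_derivative:
  "Ck_on (Suc k) S f \<Longrightarrow> x \<in> S \<Longrightarrow> (f has_derivative frechet_derivative f (at x)) (at x)"
  by (simp add: frechet_derivative_works[symmetric])

lemma Ck_on_const: "open S \<Longrightarrow> Ck_on k S (\<lambda>x. c)"
proof (induction k arbitrary: c)
  case (Suc k)
  show ?case by (rule Ck_on_has_derivative[OF Suc.prems, of _ "\<lambda>_ _. 0"]) (use Suc in auto)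
qed simp

lemma Ck_on_linear: "open S \<Longrightarrow> bounded_linear A \<Longrightarrow> Ck_on k S A"
proof (cases k)
  case (Suc m)
  assume "open S" "bounded_linear A"
  then show ?thesis unfolding Suc
    by (intro Ck_on_has_derivative[of S A "\<lambda>_. A"] Ck_on_const bounded_linear_imp_has_derivative) auto
qed (auto intro: linear_continuous_on)

lemma Ck_on_linear_compose:
  assumes "bounded_linear A" "open S" "Ck_on k S f"
  shows "Ck_on k S (\<lambda>x. A (f x))"
  using assms(3)
proof (induction k arbitrary: f)
  case 0 then show ?case using assms(1)
    by (auto intro: bounded_linear.continuous_on)
next
  case (Suc k)
  show ?case
  proof (rule Ck_on_has_derivative[OF assms(2)])
    show "((\<lambda>x. A (f x)) has_derivative (\<lambda>h. A (frechet_derivative f (at x) h))) (at x)" if "x \<in> S" for x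
      by (rule bounded_linear.has_derivative[OF assms(1) Ck_on_Suc_derivative[OF Suc.prems that]])
    show "Ck_on k S (\<lambda>x. A (frechet_derivative f (at x) h))" for h
      using Suc by simp
  qed
qed

lemma Ck_on_add:
  assumes "open S" "Ck_on k S f" "Ck_on k S g"
  shows "Ck_on k S (\<lambda>x. f x + g x)"
  using assms(2,3)
proof (induction k arbitrary: f g)
  case 0 then show ?case by (auto intro: continuous_intros)
next
  case (Suc k)
  show ?case
  proof (rule Ck_on_has_derivative[OF assms(1)])
    show "((\<lambda>x. f x + g x) has_derivative
        (\<lambda>h. frechet_derivative f (at x) h + frechet_derivative g (at x) h)) (at x)" if "x \<in> S" for x
      by (intro has_derivative_add Ck_on_Suc_derivative[OF Suc.prems(1) that] Ck_on_Suc_derivative[OF Suc.prems(2) that])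
    show "Ck_on k S (\<lambda>x. frechet_derivative f (at x) h + frechet_derivative g (at x) h)" for h
      using Suc by simp
  qed
qed

lemma Ck_on_sum:
  assumes "open S" "finite I" "\<And>i. i \<in> I \<Longrightarrow> Ck_on k S (f i)"
  shows "Ck_on k S (\<lambda>x. \<Sum>i\<in>I. f i x)"
  using assms(2,3) by (induction I rule: finite_induct) (auto intro: Ck_on_const Ck_on_add assms(1))

lemma Ck_on_scaleR:
  fixes f :: "'a::real_normed_vector \<Rightarrow> real"
  assumes "open S" "Ck_on k S f" "Ck_on k S g"
  shows "Ck_on k S (\<lambda>x. f x *\<^sub>R g x)"
  using assms(2,3)
proof (induction k arbitrary: f g)
  case 0 then show ?case by (auto intro: continuous_intros)
next
  case (Suc k)
  show ?case
  proof (rule Ck_on_has_derivative[OF assms(1)])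
    show "((\<lambda>x. f x *\<^sub>R g x) has_derivative
        (\<lambda>h. f x *\<^sub>R frechet_derivative g (at x) h + frechet_derivative f (at x) h *\<^sub>R g x)) (at x)" if "x \<in> S" for x
      by (intro has_derivative_scaleR Ck_on_Suc_derivative[OF Suc.prems(1) that] Ck_on_Suc_derivative[OF Suc.prems(2) that])
    have "Ck_on k S (\<lambda>x. frechet_derivative f (at x) h)" "Ck_on k S (\<lambda>x. frechet_derivative g (at x) h)" for h
      using Suc.prems by auto
    then show "Ck_on k S (\<lambda>x. f x *\<^sub>R frechet_derivative g (at x) h + frechet_derivative f (at x) h *\<^sub>R g x)" for h
      using Suc.prems[THEN Ck_on_Suc_imp] by (intro Ck_on_add[OF assms(1)] Suc.IH)
  qed
qed

text \<open>\<open>Ck_on\<close> controls derivatives in a fixed direction only, whereas the chain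
  rule evaluates the derivative of \<open>g\<close> in a direction that varies with
  \<open>x\<close>. Expanding that direction in the basis reduces it to fixed directions with
  varying coefficients.\<close>

lemma Ck_on_compose:
  fixes f :: "'a::real_normed_vector \<Rightarrow> 'b::euclidean_space" and g :: "'b \<Rightarrow> 'c::real_normed_vector"
  assumes "open S" "Ck_on k S f" "Ck_on k T g" "f ` S \<subseteq> T"
  shows "Ck_on k S (\<lambda>x. g (f x))"
  using assms(2,3)
proof (induction k arbitrary: g)
  case 0
  then show ?case using continuous_on_compose2[of T g S f] assms(4) by simp
next
  case (Suc k)
  let ?f' = "\<lambda>x. frechet_derivative f (at x)" and ?g' = "\<lambda>y. frechet_derivative g (at y)"
  show ?case
  proof (rule Ck_on_has_derivative[OF assms(1)])
    fix x assume x: "x \<in> S"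
    then have g': "(g has_derivative ?g' (f x)) (at (f x))"
      using assms(4) by (intro Ck_on_Suc_derivative[OF Suc.prems(2)]) auto
    have chain: "((\<lambda>x. g (f x)) has_derivative (\<lambda>h. ?g' (f x) (?f' x h))) (at x)"
      using has_derivative_compose[OF Ck_on_Suc_derivative[OF Suc.prems(1) x] g'] .
    have expand: "?g' (f x) y = (\<Sum>b\<in>Basis. (y \<bullet> b) *\<^sub>R ?g' (f x) b)" for y
    proof -
      interpret g': bounded_linear "?g' (f x)" using g' by (rule has_derivative_bounded_linear)
      have "?g' (f x) y = ?g' (f x) (\<Sum>b\<in>Basis. (y \<bullet> b) *\<^sub>R b)" by (simp only: euclidean_representation)
      then show ?thesis by (simp only: g'.sum g'.scaleR)
    qed
    show "((\<lambda>x. g (f x)) has_derivative (\<lambda>h. \<Sum>b\<in>Basis. (?f' x h \<bullet> b) *\<^sub>R ?g' (f x) b)) (at x)"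
      by (rule has_derivative_eq_rhs[OF chain]) (rule ext, rule expand)
  next
    fix h
    have f': "Ck_on k S (\<lambda>x. ?f' x h)" using Suc.prems(1) by simp
    have "Ck_on k S (\<lambda>x. (?f' x h \<bullet> b) *\<^sub>R ?g' (f x) b)" for b
    proof (rule Ck_on_scaleR[OF assms(1)])
      show "Ck_on k S (\<lambda>x. ?f' x h \<bullet> b)"
        using Ck_on_linear_compose[OF bounded_linear_inner_left assms(1) f'] .
      show "Ck_on k S (\<lambda>x. ?g' (f x) b)"
        using Suc.prems by (intro Suc.IH Ck_on_Suc_imp[OF Suc.prems(1)]) simp
    qed
    then show "Ck_on k S (\<lambda>x. \<Sum>b\<in>Basis. (?f' x h \<bullet> b) *\<^sub>R ?g' (f x) b)"
      by (intro Ck_on_sum[OF assms(1)]) auto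
  qed
qed

lemma Ck_on_Pair:
  assumes "open S" "Ck_on k S f" "Ck_on k S g"
  shows "Ck_on k S (\<lambda>x. (f x, g x))"
proof -
  have l: "bounded_linear (\<lambda>y. (y, 0))" and r: "bounded_linear (\<lambda>y. (0, y))"
    by (intro bounded_linear_Pair bounded_linear_ident bounded_linear_zero)+
  have "Ck_on k S (\<lambda>x. (f x, 0) + (0, g x))"
    by (intro Ck_on_add assms Ck_on_linear_compose[OF l] Ck_on_linear_compose[OF r])
  then show ?thesis by simp
qed

lemma smooth_on_subset: "smooth_on S f \<Longrightarrow> T \<subseteq> S \<Longrightarrow> smooth_on T f"
  unfolding smooth_on_def using Ck_on_subset by blast

lemma smooth_on_cong: "open S \<Longrightarrow> (\<And>x. x \<in> S \<Longrightarrow> f x = g x) \<Longrightarrow> smooth_on S f \<Longrightarrow> smooth_on S g"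
  unfolding smooth_on_def using Ck_on_cong by blast

lemma smooth_on_local:
  assumes "\<And>x. x \<in> S \<Longrightarrow> \<exists>T. open T \<and> x \<in> T \<and> smooth_on T f"
  shows "smooth_on S f"
  using assms unfolding smooth_on_def by (intro allI Ck_on_local) blast

lemma smooth_on_const: "open S \<Longrightarrow> smooth_on S (\<lambda>x. c)"
  by (simp add: smooth_on_def Ck_on_const)

lemma smooth_on_linear: "open S \<Longrightarrow> bounded_linear A \<Longrightarrow> smooth_on S A"
  by (simp add: smooth_on_def Ck_on_linear)

lemma smooth_on_compose:
  fixes f :: "'a::real_normed_vector \<Rightarrow> 'b::euclidean_space" and g :: "'b \<Rightarrow> 'c::real_normed_vector"
  shows "open S \<Longrightarrow> smooth_on S f \<Longrightarrow> smooth_on T g \<Longrightarrow> f ` S \<subseteq> T \<Longrightarrow> smooth_on S (\<lambda>x. g (f x))"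
  unfolding smooth_on_def using Ck_on_compose by blast

lemma smooth_on_Pair: "open S \<Longrightarrow> smooth_on S f \<Longrightarrow> smooth_on S g \<Longrightarrow> smooth_on S (\<lambda>x. (f x, g x))"
  by (simp add: smooth_on_def Ck_on_Pair)

lemma smooth_on_continuous_on: "smooth_on S f \<Longrightarrow> continuous_on S f"
  unfolding smooth_on_def using Ck_on.simps(1) by blast

lemma smooth_on_has_derivative:
  "smooth_on S f \<Longrightarrow> x \<in> S \<Longrightarrow> (f has_derivative frechet_derivative f (at x)) (at x)"
  unfolding smooth_on_def using Ck_on_Suc_derivative by blast

lemma smooth_on_frechet_derivative:
  "smooth_on S f \<Longrightarrow> smooth_on S (\<lambda>x. frechet_derivative f (at x) h)"
  unfolding smooth_on_def by (metis Ck_on.simps(2))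

section \<open>Left-invariant fields and their connection\<close>

lemma chart_exists: "\<exists>U \<phi>. (U, \<phi>) \<in> charts \<and> (p::'g::lie_group3) \<in> U"
proof -
  have "p \<in> (\<Union>(U, \<phi>)\<in>charts. U)" by (simp only: charts_cover UNIV_I)
  then show ?thesis by auto
qed

lemma chart_open: "(U, \<phi>) \<in> charts \<Longrightarrow> open (U::'g::lie_group3 set)"
  using charts_homeomorphism by blast

lemma chart_inj: "(U, \<phi>) \<in> charts \<Longrightarrow> inj_on \<phi> (U::'g::lie_group3 set)"
  using charts_homeomorphism by blast

lemma chart_open_image:
  "(U, \<phi>) \<in> charts \<Longrightarrow> W \<subseteq> (U::'g::lie_group3 set) \<Longrightarrow> open (\<phi> ` W) \<longleftrightarrow> open W"
  using charts_homeomorphism by blast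

lemma chart_image_open: "(U, \<phi>) \<in> charts \<Longrightarrow> open (\<phi> ` (U::'g::lie_group3 set))"
  by (simp add: chart_open_image chart_open)

lemma chart_inverse:
  "(U, \<phi>) \<in> charts \<Longrightarrow> p \<in> (U::'g::lie_group3 set) \<Longrightarrow> inv_into U \<phi> (\<phi> p) = p"
  by (simp add: chart_inj)

lemma chart_inverse_continuous:
  assumes chart: "(U, \<phi>) \<in> charts"
  shows "continuous_on (\<phi> ` U) (inv_into U \<phi> :: real^3 \<Rightarrow> 'g::lie_group3)"
  unfolding continuous_on_open_vimage[OF chart_image_open[OF chart]]
proof (intro allI impI)
  fix W :: "'g set" assume "open W"
  have "inv_into U \<phi> -` W \<inter> \<phi> ` U = \<phi> ` (U \<inter> W)"
    using chart_inverse[OF chart] by auto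
  then show "open (inv_into U \<phi> -` W \<inter> \<phi> ` U)"
    using chart_open_image[OF chart, of "U \<inter> W"] chart_open[OF chart] \<open>open W\<close> by auto
qed

text \<open>Smoothness of curves, extended to parameters in any Euclidean space: the proof that
  left-invariant fields are smooth uses maps of chart coordinates and time jointly.\<close>

definition smooth_into :: "'e::euclidean_space set \<Rightarrow> ('e \<Rightarrow> 'g::lie_group3) \<Rightarrow> bool" where
  "smooth_into S a \<longleftrightarrow> continuous_on S a \<and> (\<forall>(U, \<phi>)\<in>charts. smooth_on {x \<in> S. a x \<in> U} (\<phi> \<circ> a))"

lemma smooth_curve_on_iff: "smooth_curve_on I c \<longleftrightarrow> smooth_into I c"
  by (simp add: smooth_curve_on_def smooth_into_def)

lemma smooth_into_chart:
  "smooth_into S a \<Longrightarrow> (U, \<phi>) \<in> charts \<Longrightarrow> smooth_on {x \<in> S. a x \<in> U} (\<lambda>x. \<phi> (a x))"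
  unfolding smooth_into_def o_def by blast

lemma open_preimage: "open S \<Longrightarrow> continuous_on S a \<Longrightarrow> open U \<Longrightarrow> open {x \<in> S. a x \<in> U}"
  using continuous_on_open_vimage[of S a] by (simp add: vimage_def Int_def conj_commute)

lemma smooth_into_open:
  "open S \<Longrightarrow> smooth_into S a \<Longrightarrow> open U \<Longrightarrow> open {x \<in> S. a x \<in> U}"
  by (simp add: smooth_into_def open_preimage)

lemma smooth_into_const: "open S \<Longrightarrow> smooth_into S (\<lambda>x. p)"
  by (auto simp: smooth_into_def o_def intro: smooth_on_subset[OF smooth_on_const])

lemma smooth_into_inverse_chart:
  assumes chart: "(U, \<phi>) \<in> charts"
  shows "smooth_into (\<phi> ` U) (inv_into U \<phi> :: real^3 \<Rightarrow> 'g::lie_group3)"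
  unfolding smooth_into_def
proof (intro conjI chart_inverse_continuous[OF chart], clarify)
  fix V :: "'g set" and \<eta> assume V: "(V, \<eta>) \<in> charts"
  have "{x \<in> \<phi> ` U. inv_into U \<phi> x \<in> V} = \<phi> ` (U \<inter> V)"
    using chart_inverse[OF chart] by auto
  then show "smooth_on {x \<in> \<phi> ` U. inv_into U \<phi> x \<in> V} (\<eta> \<circ> inv_into U \<phi>)"
    using charts_compatible[OF chart V] by simp
qed

lemma smooth_into_compose:
  assumes "open S" "smooth_on S g" "g ` S \<subseteq> T" "smooth_into T a"
  shows "smooth_into S (\<lambda>x. a (g x))"
proof -
  have cont: "continuous_on S (\<lambda>x. a (g x))"
    using assms by (intro continuous_on_compose2[of T a S g] smooth_on_continuous_on) (auto simp: smooth_into_def)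
  have "smooth_on {x \<in> S. a (g x) \<in> U} (\<lambda>x. \<phi> (a (g x)))" if chart: "(U, \<phi>) \<in> charts" for U \<phi>
    by (rule smooth_on_compose[where g="\<lambda>y. \<phi> (a y)", OF open_preimage[OF assms(1) cont chart_open[OF chart]]
          smooth_on_subset[OF assms(2)] smooth_into_chart[OF assms(4) chart]])
      (use assms(3) in auto)
  with cont show ?thesis by (auto simp: smooth_into_def o_def)
qed

lemma smooth_into_plus:
  assumes "open S" "smooth_into S a" "smooth_into S b"
  shows "smooth_into S (\<lambda>x. a x + b x)"
proof -
  have cont: "continuous_on S (\<lambda>x. a x + b x)"
    using assms by (intro continuous_on_add) (simp_all add: smooth_into_def)
  have "smooth_on {x \<in> S. a x + b x \<in> W} (\<psi> \<circ> (\<lambda>x. a x + b x))" if W: "(W, \<psi>) \<in> charts" for W \<psi>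
  proof (rule smooth_on_local)
    fix x0 assume x0: "x0 \<in> {x \<in> S. a x + b x \<in> W}"
    obtain U \<phi> where U: "(U, \<phi>) \<in> charts" "a x0 \<in> U" using chart_exists by blast
    obtain V \<eta> where V: "(V, \<eta>) \<in> charts" "b x0 \<in> V" using chart_exists by blast
    define T where "T = {x \<in> S. a x + b x \<in> W} \<inter> {x \<in> S. a x \<in> U} \<inter> {x \<in> S. b x \<in> V}"
    have T: "open T"
      unfolding T_def using assms cont W U V
      by (intro open_Int open_preimage smooth_into_open) (auto intro: chart_open)
    let ?g = "\<lambda>(x, y). \<psi> (inv_into U \<phi> x + inv_into V \<eta> y)"
    have "smooth_on T (\<lambda>x. ?g (\<phi> (a x), \<eta> (b x)))"
    proof (rule smooth_on_compose[OF T, where g="?g"])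
      show "smooth_on T (\<lambda>x. (\<phi> (a x), \<eta> (b x)))"
        by (rule smooth_on_Pair[OF T smooth_on_subset[OF smooth_into_chart[OF assms(2) U(1)]]
            smooth_on_subset[OF smooth_into_chart[OF assms(3) V(1)]]]) (auto simp: T_def)
      show "smooth_on {(x, y). x \<in> \<phi> ` U \<and> y \<in> \<eta> ` V \<and> inv_into U \<phi> x + inv_into V \<eta> y \<in> W} ?g"
        by (rule smooth_plus[OF U(1) V(1) W])
    qed (auto simp: T_def chart_inverse[OF U(1)] chart_inverse[OF V(1)])
    then have "smooth_on T (\<psi> \<circ> (\<lambda>x. a x + b x))"
      by (rule smooth_on_cong[OF T, rotated]) (auto simp: T_def chart_inverse[OF U(1)] chart_inverse[OF V(1)])
    then show "\<exists>T. open T \<and> x0 \<in> T \<and> smooth_on T (\<psi> \<circ> (\<lambda>x. a x + b x))"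
      using T x0 U V by (intro exI[of _ T]) (auto simp: T_def)
  qed
  with cont show ?thesis by (auto simp: smooth_into_def)
qed

lemma smooth_fun_compose:
  assumes "open S" "smooth_into S a" "smooth_fun f"
  shows "smooth_on S (\<lambda>x. f (a x))"
proof (rule smooth_on_local)
  fix x0 assume x0: "x0 \<in> S"
  obtain U \<phi> where U: "(U, \<phi>) \<in> charts" "a x0 \<in> U" using chart_exists by blast
  define T where "T = {x \<in> S. a x \<in> U}"
  have T: "open T"
    unfolding T_def by (intro smooth_into_open assms chart_open[OF U(1)])
  have "smooth_on T (\<lambda>x. (f \<circ> inv_into U \<phi>) (\<phi> (a x)))"
    by (rule smooth_on_compose[OF T smooth_into_chart[OF assms(2) U(1), folded T_def],
          where g="f \<circ> inv_into U \<phi>" and T="\<phi> ` U"])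
      (use assms(3) U(1) in \<open>auto simp: smooth_fun_def T_def\<close>)
  then have "smooth_on T (\<lambda>x. f (a x))"
    by (rule smooth_on_cong[OF T, rotated]) (auto simp: T_def chart_inverse[OF U(1)])
  then show "\<exists>T. open T \<and> x0 \<in> T \<and> smooth_on T (\<lambda>x. f (a x))"
    using T x0 U by (intro exI[of _ T]) (auto simp: T_def)
qed

text \<open>The equivalence is essential for translating velocities: \<open>velocity\<close> is 0 on
  functions that are not smooth, so translation must preserve non-smoothness too.\<close>

lemma smooth_fun_translate: "smooth_fun (\<lambda>h. f (p + h)) \<longleftrightarrow> smooth_fun (f :: 'g::lie_group3 \<Rightarrow> real)"
proof -
  have *: "smooth_fun (\<lambda>h. f (p + h))" if "smooth_fun f" for f and p :: 'g
    unfolding smooth_fun_def o_def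
  proof clarify
    fix U :: "'g set" and \<phi> assume chart: "(U, \<phi>) \<in> charts"
    show "smooth_on (\<phi> ` U) (\<lambda>x. f (p + inv_into U \<phi> x))"
      by (rule smooth_fun_compose[OF chart_image_open[OF chart] smooth_into_plus[OF
            chart_image_open[OF chart] smooth_into_const[OF chart_image_open[OF chart]]
            smooth_into_inverse_chart[OF chart]] that])
  qed
  show ?thesis
    using *[of f p] *[of "\<lambda>h. f (p + h)" "- p"] by (auto simp: add.assoc[symmetric])
qed

section \<open>Left translation of tangent vectors and left-invariant fields\<close>

lemma DL_DL: "DL a (DL b v) = DL (a + b) v"
  by (simp add: DL_def add.assoc)

lemma DL_0 [simp]: "DL 0 v = v"
  by (simp add: DL_def)

lemma DL_cancel: "DL (- p) (DL p v) = v" "DL p (DL (- p) v) = v"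
  by (simp_all add: DL_DL)

lemma DL_velocity: "DL p (velocity c t) = velocity (\<lambda>s. p + c s) t"
  by (rule ext) (simp add: DL_def velocity_def smooth_fun_translate o_def)

lemma DL_tangent_space:
  assumes "v \<in> tangent_space q" shows "DL p v \<in> tangent_space (p + q)"
proof -
  obtain c \<epsilon> where c: "v = velocity c 0" "0 < \<epsilon>" "smooth_curve_on {-\<epsilon><..<\<epsilon>} c" "c 0 = q"
    using assms by (auto simp: tangent_space_def)
  have "smooth_curve_on {-\<epsilon><..<\<epsilon>} (\<lambda>s. p + c s)"
    using c(3) unfolding smooth_curve_on_iff
    by (intro smooth_into_plus smooth_into_const) auto
  with c show ?thesis unfolding tangent_space_def c(1) DL_velocity by fastforce
qed

lemma tangent_space_const: "v \<in> tangent_space p \<Longrightarrow> v (\<lambda>h. k) = 0"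
  by (auto simp: tangent_space_def velocity_def o_def)

text \<open>If \<open>v\<close> is the velocity of \<open>c\<close> at 0, the field applied to
  \<open>f\<close> at \<open>p\<close> is the time derivative of \<open>f (p + c t)\<close> at 0. In
  a chart this is a partial derivative of the smooth function \<open>H\<close> of coordinates and
  time, hence smooth in the coordinates.\<close>

lemma smooth_left_inv:
  assumes "v \<in> tangent_space (0 :: 'g::lie_group3)"
  shows "smooth_vfield (left_inv v)"
  unfolding smooth_vfield_def
proof (intro conjI allI impI)
  show "left_inv v p \<in> tangent_space p" for p
    using DL_tangent_space[OF assms, of p] by (simp add: left_inv_def)
next
  fix f :: "'g \<Rightarrow> real" assume f: "smooth_fun f"
  obtain c \<epsilon> where c: "v = velocity c 0" "0 < \<epsilon>" "smooth_curve_on {-\<epsilon><..<\<epsilon>} c" "c 0 = 0"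
    using assms by (auto simp: tangent_space_def)
  show "smooth_fun (\<lambda>p. left_inv v p f)"
    unfolding smooth_fun_def
  proof clarify
    fix U :: "'g set" and \<phi> assume chart: "(U, \<phi>) \<in> charts"
    define S where "S = Sigma (\<phi> ` U) (\<lambda>_. {-\<epsilon><..<\<epsilon>})"
    have S: "open S" unfolding S_def by (intro open_Times chart_image_open[OF chart]) auto
    define H where "H z = f (inv_into U \<phi> (fst z) + c (snd z))" for z
    have "smooth_on S H"
      unfolding H_def
    proof (intro smooth_fun_compose S f smooth_into_plus)
      show "smooth_into S (\<lambda>z. inv_into U \<phi> (fst z))"
        by (rule smooth_into_compose[OF S smooth_on_linear[OF S bounded_linear_fst] _ smooth_into_inverse_chart[OF chart]])
          (auto simp: S_def)
      show "smooth_into S (\<lambda>z. c (snd z))"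
        by (rule smooth_into_compose[OF S smooth_on_linear[OF S bounded_linear_snd] _ c(3)[unfolded smooth_curve_on_iff]])
          (auto simp: S_def)
    qed
    have eq: "(left_inv v (inv_into U \<phi> x)) f = frechet_derivative H (at (x, 0)) (0, 1)" if "x \<in> \<phi> ` U" for x
    proof -
      have "(H has_derivative frechet_derivative H (at (x, 0))) (at (x, 0))"
        by (rule smooth_on_has_derivative[OF \<open>smooth_on S H\<close>]) (use that c(2) in \<open>auto simp: S_def\<close>)
      note H' = this
      have "((\<lambda>t. (x, t)) has_derivative (\<lambda>h. (0, h))) (at 0)"
        by (auto intro!: derivative_eq_intros)
      from has_derivative_compose[OF this H']
      have "((\<lambda>t. H (x, t)) has_derivative (\<lambda>h. frechet_derivative H (at (x, 0)) (0, h))) (at 0)" .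
      moreover have "frechet_derivative H (at (x, 0)) (0, h) = frechet_derivative H (at (x, 0)) (0, 1) * h" for h
        using linear_scale[OF has_derivative_linear[OF H'], of h "(0, 1)"] by (simp add: mult.commute)
      then have "(\<lambda>h. frechet_derivative H (at (x, 0)) (0, h)) = (*) (frechet_derivative H (at (x, 0)) (0, 1))"
        by (rule ext)
      ultimately have "((\<lambda>t. H (x, t)) has_real_derivative frechet_derivative H (at (x, 0)) (0, 1)) (at 0)"
        by (simp only: has_field_derivative_def)
      then have "deriv (\<lambda>t. H (x, t)) 0 = frechet_derivative H (at (x, 0)) (0, 1)"
        by (rule DERIV_imp_deriv)
      then show ?thesis
        using f by (simp only: left_inv_def c(1) DL_velocity) (simp add: velocity_def o_def H_def)
    qed
    have "smooth_on (\<phi> ` U) (\<lambda>x. frechet_derivative H (at (x, 0)) (0, 1))"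
    proof (rule smooth_on_compose[OF chart_image_open[OF chart] _ smooth_on_frechet_derivative[OF \<open>smooth_on S H\<close>]])
      show "smooth_on (\<phi> ` U) (\<lambda>x. (x, 0 :: real))"
        by (intro smooth_on_linear chart_image_open[OF chart] bounded_linear_Pair bounded_linear_ident bounded_linear_zero)
    qed (use c(2) in \<open>auto simp: S_def\<close>)
    then show "smooth_on (\<phi> ` U) ((\<lambda>p. left_inv v p f) \<circ> inv_into U \<phi>)"
      by (rule smooth_on_cong[OF chart_image_open[OF chart], rotated]) (simp add: eq)
  qed
qed

lemma lie_bracket_left_inv:
  "lie_bracket (left_inv v) (left_inv w) = left_inv (la_bracket v w)"
  by (simp add: lie_bracket_def left_inv_def la_bracket_def DL_def add.assoc fun_eq_iff)

lemma extend_DL: "extend p (DL p v) = left_inv v"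
  by (simp add: extend_def DL_cancel)

lemma levi_civita_smooth:
  assumes "levi_civita M N" "smooth_vfield X" "smooth_vfield Y"
  shows "smooth_vfield (N X Y)"
  using assms(1)[unfolded levi_civita_def, THEN conjunct1] assms(2,3) by simp

lemma levi_civita_torsion_free:
  assumes "levi_civita M N" "smooth_vfield X" "smooth_vfield Y"
  shows "(\<lambda>p f. N X Y p f - N Y X p f) = lie_bracket X Y"
  using assms(1)[unfolded levi_civita_def, THEN conjunct2, THEN conjunct2, THEN conjunct2, THEN conjunct2,
      THEN conjunct1] assms(2,3) by simp

lemma levi_civita_metric:
  assumes "levi_civita M N" "smooth_vfield X" "smooth_vfield Y" "smooth_vfield Z"
  shows "X p (\<lambda>q. M q (Y q) (Z q)) = M p (N X Y p) (Z p) + M p (Y p) (N X Z p)"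
  using assms(1)[unfolded levi_civita_def, THEN conjunct2, THEN conjunct2, THEN conjunct2, THEN conjunct2,
      THEN conjunct2] assms(2-4) by simp

section \<open>Connection and curvature in the left-invariant frame\<close>

locale left_invariant_connection = self_adjoint3 +
  fixes M :: "'g::lie_group3 \<Rightarrow> 'g tvec \<Rightarrow> 'g tvec \<Rightarrow> real"
    and N :: "'g vfield \<Rightarrow> 'g vfield \<Rightarrow> 'g vfield"
    and \<iota> :: "real^3 \<Rightarrow> 'g tvec"
  assumes metric: "left_invariant_metric M"
    and connection: "levi_civita M N"
    and iso: "orthonormal_iso M \<iota>"
    and bracket: "\<And>a b. la_bracket (\<iota> a) (\<iota> b) = \<iota> (L (a \<times> b))"
begin

definition field_at :: "'g \<Rightarrow> real^3 \<Rightarrow> 'g tvec" where "field_at p a = DL p (\<iota> a)"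

lemma \<iota>_tangent: "\<iota> a \<in> tangent_space 0"
  using iso by (auto simp: orthonormal_iso_def bij_betw_def)

lemma field_at_linear: "linear (\<lambda>a. field_at p a f)"
  using iso by (simp add: orthonormal_iso_def field_at_def DL_def)

lemma field_at_tangent: "field_at p a \<in> tangent_space p"
  using DL_tangent_space[OF \<iota>_tangent, of p] by (simp add: field_at_def)

lemma tangent_field_at: "v \<in> tangent_space p \<Longrightarrow> \<exists>a. v = field_at p a"
proof -
  assume "v \<in> tangent_space p"
  then have "DL (- p) v \<in> tangent_space 0" using DL_tangent_space[of v p "- p"] by simp
  then have "DL (- p) v \<in> range \<iota>"
    using iso by (simp add: orthonormal_iso_def bij_betw_def)
  then obtain a where "DL (- p) v = \<iota> a" by blast
  then have "v = field_at p a" unfolding field_at_def by (metis DL_cancel(2))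
  then show ?thesis ..
qed

lemma field_at_inj: "field_at p a = field_at p b \<longleftrightarrow> a = b"
proof
  assume "field_at p a = field_at p b"
  then have "\<iota> a = \<iota> b" unfolding field_at_def by (metis DL_cancel(1))
  then show "a = b" using iso by (auto simp: orthonormal_iso_def bij_betw_def inj_def)
qed simp

lemma field_at_eq_0: "field_at p a = (\<lambda>f. 0) \<longleftrightarrow> a = 0"
  using field_at_inj[of p a 0] linear_0[OF field_at_linear[of p]] by (metis ext)

lemma coords_field_at: "coords \<iota> p (field_at p a) = a"
  unfolding coords_def by (rule the_equality) (auto simp: field_at_def[symmetric] field_at_inj)

lemma M_field_at: "M p (field_at p a) (field_at p b) = a \<bullet> b"
proof -
  have "M (p + 0) (DL p (\<iota> a)) (DL p (\<iota> b)) = M 0 (\<iota> a) (\<iota> b)"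
    using metric \<iota>_tangent unfolding left_invariant_metric_def by blast
  then show ?thesis using iso by (simp add: field_at_def orthonormal_iso_def)
qed

definition frame_field :: "real^3 \<Rightarrow> 'g vfield" where "frame_field a = left_inv (\<iota> a)"

lemma frame_field_apply: "frame_field a p = field_at p a"
  by (simp add: frame_field_def left_inv_def field_at_def)

lemma frame_field_smooth: "smooth_vfield (frame_field a)"
  unfolding frame_field_def by (rule smooth_left_inv[OF \<iota>_tangent])

lemma frame_field_bracket: "lie_bracket (frame_field a) (frame_field b) = frame_field (L (a \<times> b))"
  by (simp add: frame_field_def lie_bracket_left_inv bracket)

text \<open>Inner products of left-invariant fields are constant, so the derivative terms of the
  Koszul formula vanish; \<open>skew\<close> and \<open>torsion\<close> are what remains of the two
  defining properties and determine the connection at each point.\<close>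

lemma connection_frame: "N (frame_field a) (frame_field b) = frame_field (K a \<times> b)"
proof (rule ext)
  fix p
  have "smooth_vfield (N (frame_field a) (frame_field b))" for a b
    by (intro levi_civita_smooth[OF connection] frame_field_smooth)
  then have "\<exists>n. N (frame_field a) (frame_field b) p = field_at p n" for a b
    unfolding smooth_vfield_def using tangent_field_at by blast
  then obtain n where n: "\<And>a b. N (frame_field a) (frame_field b) p = field_at p (n a b)" by metis
  have skew: "n a b \<bullet> c + b \<bullet> n a c = 0" for a b c
  proof -
    have "frame_field a p (\<lambda>q. M q (frame_field b q) (frame_field c q)) =
        M p (N (frame_field a) (frame_field b) p) (frame_field c p) + M p (frame_field b p) (N (frame_field a) (frame_field c) p)"
      by (intro levi_civita_metric[OF connection] frame_field_smooth)
    then show ?thesis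
      by (simp add: n frame_field_apply M_field_at tangent_space_const[OF field_at_tangent])
  qed
  have torsion: "n a b - n b a = L (a \<times> b)" for a b
  proof -
    have "(\<lambda>p f. N (frame_field a) (frame_field b) p f - N (frame_field b) (frame_field a) p f) = frame_field (L (a \<times> b))"
      unfolding frame_field_bracket[symmetric]
      by (intro levi_civita_torsion_free[OF connection] frame_field_smooth)
    from fun_cong[OF this, of p] have "(\<lambda>f. field_at p (n a b) f - field_at p (n b a) f) = field_at p (L (a \<times> b))"
      by (simp add: n frame_field_apply)
    then have "field_at p (n a b - n b a) = field_at p (L (a \<times> b))"
      by (simp add: linear_diff[OF field_at_linear] fun_eq_iff)
    then show ?thesis by (simp add: field_at_inj)
  qed
  have "n a b = K a \<times> b"
  proof (rule vector_eq_rdot[THEN iffD1], rule allI)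
    fix c
    have t: "n a b \<bullet> c - n b a \<bullet> c = L (a \<times> b) \<bullet> c" for a b c
      by (metis inner_diff_left torsion)
    have s: "n a b \<bullet> c = - (n a c \<bullet> b)" for a b c
      using skew[of a b c] by (simp add: inner_commute)
    have "2 * (n a b \<bullet> c) = L (a \<times> b) \<bullet> c - L (b \<times> c) \<bullet> a + L (c \<times> a) \<bullet> b"
      using t[of a b c] t[of b c a] t[of c a b] s[of a b c] s[of b c a] s[of c a b] by linarith
    also have "L (b \<times> c) \<bullet> a = (L a \<times> b) \<bullet> c"
      unfolding L_self_adjoint by (metis cross_triple inner_commute)
    also have "L (c \<times> a) \<bullet> b = (a \<times> L b) \<bullet> c"
      unfolding L_self_adjoint by (metis cross_triple inner_commute)
    finally have "2 * (n a b \<bullet> c) = (L (a \<times> b) - L a \<times> b + a \<times> L b) \<bullet> c"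
      by (simp add: inner_diff_left inner_add_left)
    then show "n a b \<bullet> c = (K a \<times> b) \<bullet> c" by (simp add: koszul_cross)
  qed
  then show "N (frame_field a) (frame_field b) p = frame_field (K a \<times> b) p"
    by (simp add: n frame_field_apply)
qed

lemma nabla_field_at: "nabla_at N p (field_at p a) (frame_field b) = field_at p (K a \<times> b)"
  unfolding nabla_at_def field_at_def[of p a] extend_DL frame_field_def[symmetric]
  by (simp add: connection_frame frame_field_apply)

lemma curvature_field_at:
  "curvature_at N p (field_at p a) (field_at p b) (field_at p c) = field_at p (curv a b c)"
proof -
  have "K a \<times> (K b \<times> c) - K b \<times> (K a \<times> c) - K (L (a \<times> b)) \<times> c = curv a b c"
    unfolding curv_def by (simp add: vec_eq_iff forall_3 cross_components algebra_simps)
  then show ?thesis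
    unfolding curvature_at_def field_at_def[of p a] field_at_def[of p b] field_at_def[of p c]
      extend_DL frame_field_def[symmetric] curvature_def connection_frame frame_field_bracket
    by (simp add: frame_field_apply linear_diff[OF field_at_linear, symmetric])
qed

text \<open>No differentiability of \<open>y\<close> is assumed, because
  \<open>vector_derivative\<close> stands unevaluated on both sides. The formula therefore also
  holds at break points of piecewise smooth coefficients.\<close>

lemma cov_deriv_field_at:
  assumes "velocity \<gamma> t = field_at (\<gamma> t) a"
  shows "cov_deriv N \<iota> \<gamma> (\<lambda>t. field_at (\<gamma> t) (y t)) t =
    field_at (\<gamma> t) (vector_derivative y (at t) + K a \<times> y t)"
proof (rule ext)
  fix f
  let ?y' = "vector_derivative y (at t)" and ?E = "\<lambda>a. field_at (\<gamma> t) a f"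
  have "cov_deriv N \<iota> \<gamma> (\<lambda>t. field_at (\<gamma> t) (y t)) t f =
      (\<Sum>i\<in>UNIV. ?y' $ i * ?E (axis i 1) + y t $ i * ?E (K a \<times> axis i 1))"
    unfolding cov_deriv_def Let_def coords_field_at frame_field_def[symmetric] assms nabla_field_at
      frame_field_apply ..
  also have "\<dots> = ?E (\<Sum>i\<in>UNIV. ?y' $ i *\<^sub>R axis i 1) + ?E (\<Sum>i\<in>UNIV. y t $ i *\<^sub>R (K a \<times> axis i 1))"
    by (simp add: linear_sum[OF field_at_linear] linear_scale[OF field_at_linear] sum.distrib)
  also have "(\<Sum>i\<in>UNIV. x $ i *\<^sub>R axis i 1) = x" for x :: "real^3"
    using basis_expansion[of x] by (simp add: scalar_mult_eq_scaleR)
  also have "(\<Sum>i\<in>UNIV. y t $ i *\<^sub>R (K a \<times> axis i 1)) = K a \<times> y t"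
    by (simp add: sum_3 vec_eq_iff forall_3 cross_components axis_def)
  finally show "cov_deriv N \<iota> \<gamma> (\<lambda>t. field_at (\<gamma> t) (y t)) t f = field_at (\<gamma> t) (?y' + K a \<times> y t) f"
    by (simp add: linear_add[OF field_at_linear])
qed

end

section \<open>Index form and Jacobi fields along the geodesic\<close>

locale left_invariant_geodesic = left_invariant_connection + euler_arnold_flow +
  fixes \<gamma> :: "real \<Rightarrow> 'a"
  assumes velocity_eq: "\<And>t. velocity \<gamma> t = field_at (\<gamma> t) (u t)"
begin

lemma index_form_field_at:
  "index_form M N \<iota> \<gamma> \<tau> (\<lambda>t. field_at (\<gamma> t) (y t)) = integral {0..\<tau>} (\<lambda>t.
      (vector_derivative y (at t) + K (u t) \<times> y t) \<bullet> (vector_derivative y (at t) + K (u t) \<times> y t)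
        - curv (y t) (u t) (u t) \<bullet> y t)"
  unfolding index_form_def cov_deriv_field_at[OF velocity_eq] velocity_eq curvature_field_at M_field_at ..

text \<open>A Jacobi field is a second-order condition on \<open>y\<close>; the auxiliary
  \<open>h\<close> replaces its covariant derivative \<open>z\<close>, which equals h + K y \<times>
  u. Differentiability of \<open>z\<close> and of \<open>h\<close> then correspond.\<close>

lemma jacobi_field_iff:
  "jacobi_field N \<iota> \<gamma> (\<lambda>t. field_at (\<gamma> t) (y t)) \<longleftrightarrow> (\<exists>h. linearized y h)"
proof -
  define z where "z t = vector_derivative y (at t) + K (u t) \<times> y t" for t
  have cov: "cov_deriv N \<iota> \<gamma> (\<lambda>t. field_at (\<gamma> t) (y t)) = (\<lambda>t. field_at (\<gamma> t) (z t))"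
    by (rule ext) (simp add: cov_deriv_field_at[OF velocity_eq] z_def)
  have "jacobi_field N \<iota> \<gamma> (\<lambda>t. field_at (\<gamma> t) (y t)) \<longleftrightarrow>
    (\<forall>t. y differentiable (at t) \<and> z differentiable (at t) \<and>
      (\<forall>f. field_at (\<gamma> t) (vector_derivative z (at t) + K (u t) \<times> z t) f
         + field_at (\<gamma> t) (curv (y t) (u t) (u t)) f = 0))"
    unfolding jacobi_field_def differentiable_along_def cov cov_deriv_field_at[OF velocity_eq]
      coords_field_at velocity_eq curvature_field_at
    by (simp add: field_at_tangent)
  also have "\<dots> \<longleftrightarrow> (\<forall>t. y differentiable (at t) \<and> z differentiable (at t) \<and>
      vector_derivative z (at t) + K (u t) \<times> z t + curv (y t) (u t) (u t) = 0)"
    unfolding linear_add[OF field_at_linear, symmetric]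
    using field_at_eq_0 by (simp add: fun_eq_iff)
  also have "\<dots> \<longleftrightarrow> (\<exists>h. linearized y h)"
  proof
    assume *: "\<forall>t. y differentiable (at t) \<and> z differentiable (at t) \<and>
      vector_derivative z (at t) + K (u t) \<times> z t + curv (y t) (u t) (u t) = 0"
    define h where "h t = z t - K (y t) \<times> u t" for t
    have y: "(y has_vector_derivative h t - L (u t \<times> y t)) (at t)" for t
    proof -
      have "h t - L (u t \<times> y t) = vector_derivative y (at t)"
        using covariant_eq_variation[of "h t" "u t" "y t"] by (simp add: h_def z_def algebra_simps)
      then show ?thesis using * by (metis vector_derivative_works)
    qed
    have "(h has_vector_derivative - (h t \<times> L (u t) + u t \<times> L (h t))) (at t)" for t
    proof -
      define h' where "h' = vector_derivative z (at t) - (K (y t) \<times> u' t + K (h t - L (u t \<times> y t)) \<times> u t)"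
      have "(z has_vector_derivative vector_derivative z (at t)) (at t)"
        using * by (simp add: vector_derivative_works)
      then have "(h has_vector_derivative h') (at t)"
        unfolding h_def[abs_def] h'_def
        by (intro vector_derivatives y[unfolded h_def] u_deriv)
      moreover have "h' + h t \<times> L (u t) + u t \<times> L (h t) = 0"
      proof -
        have z: "z t = h t + K (y t) \<times> u t" by (simp add: h_def)
        show ?thesis
          unfolding jacobi_eq_linearized[symmetric, where y="y t"] u'_eq[symmetric] z[symmetric]
          using * by (simp add: h'_def algebra_simps)
      qed
      then have "h' = - (h t \<times> L (u t) + u t \<times> L (h t))"
        by (simp only: eq_neg_iff_add_eq_0 add.assoc)
      ultimately show ?thesis by simp
    qed
    with y have "linearized y h" by (simp add: linearized_def)
    then show "\<exists>h. linearized y h" by blast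
  next
    assume "\<exists>h. linearized y h"
    then obtain h where lin: "linearized y h" by blast
    note d = linearized_deriv[OF lin]
    have "z t = h t + K (y t) \<times> u t" for t
      unfolding z_def vector_derivative_at[OF d(1)] by (rule covariant_eq_variation)
    then have z: "z = (\<lambda>t. h t + K (y t) \<times> u t)" by (rule ext)
    have z': "(z has_vector_derivative - (h t \<times> L (u t) + u t \<times> L (h t))
        + (K (y t) \<times> u' t + K (h t - L (u t \<times> y t)) \<times> u t)) (at t)" for t
      unfolding z by (intro vector_derivatives d u_deriv)
    show "\<forall>t. y differentiable (at t) \<and> z differentiable (at t) \<and>
      vector_derivative z (at t) + K (u t) \<times> z t + curv (y t) (u t) (u t) = 0"
    proof (intro allI conjI)
      fix t
      show "y differentiable (at t)" "z differentiable (at t)"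
        using d(1) z' by (auto simp: has_vector_derivative_def differentiable_def)
      show "vector_derivative z (at t) + K (u t) \<times> z t + curv (y t) (u t) (u t) = 0"
        unfolding vector_derivative_at[OF z'] unfolding z
        using jacobi_eq_linearized[of "- (h t \<times> L (u t) + u t \<times> L (h t))" "h t" "u t" "y t"]
        by (simp add: u'_eq algebra_simps)
    qed
  qed
  finally show ?thesis .
qed

lemma conjugate_time_iff:
  "conjugate_time N \<iota> \<gamma> s \<longleftrightarrow> 0 < s \<and> (\<exists>y h. linearized y h \<and> (\<exists>t. y t \<noteq> 0) \<and> y 0 = 0 \<and> y s = 0)"
proof
  assume "conjugate_time N \<iota> \<gamma> s"
  then obtain J where J: "0 < s" "jacobi_field N \<iota> \<gamma> J" "\<exists>t. J t \<noteq> (\<lambda>f. 0)" "J 0 = (\<lambda>f. 0)" "J s = (\<lambda>f. 0)"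
    by (auto simp: conjugate_time_def)
  have "\<forall>t. \<exists>a. J t = field_at (\<gamma> t) a"
    using J(2) tangent_field_at unfolding jacobi_field_def by blast
  then obtain y where "\<And>t. J t = field_at (\<gamma> t) (y t)" by metis
  then have "J = (\<lambda>t. field_at (\<gamma> t) (y t))" by auto
  with J show "0 < s \<and> (\<exists>y h. linearized y h \<and> (\<exists>t. y t \<noteq> 0) \<and> y 0 = 0 \<and> y s = 0)"
    by (auto simp: jacobi_field_iff field_at_eq_0)
next
  assume "0 < s \<and> (\<exists>y h. linearized y h \<and> (\<exists>t. y t \<noteq> 0) \<and> y 0 = 0 \<and> y s = 0)"
  then obtain y h where "0 < s" "linearized y h" "\<exists>t. y t \<noteq> 0" "y 0 = 0" "y s = 0" by blast
  then show "conjugate_time N \<iota> \<gamma> s"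
    unfolding conjugate_time_def
    by (intro conjI exI[of _ "\<lambda>t. field_at (\<gamma> t) (y t)"]) (auto simp: jacobi_field_iff field_at_eq_0)
qed

end

unbundle no cross3_syntax

theorem theorem4p7:
  fixes M :: "'g::lie_group3 \<Rightarrow> 'g tvec \<Rightarrow> 'g tvec \<Rightarrow> real"
    and N :: "'g vfield \<Rightarrow> 'g vfield \<Rightarrow> 'g vfield"
    and \<iota> :: "real^3 \<Rightarrow> 'g tvec"
    and L :: "real^3 \<Rightarrow> real^3"
    and u u' v w :: "real \<Rightarrow> real^3"
    and \<gamma> :: "real \<Rightarrow> 'g"
    and l :: real
    and \<delta> \<xi> :: "real \<Rightarrow> real"
  assumes metric: "left_invariant_metric M"
    and connection: "levi_civita M N"
    and iso: "orthonormal_iso M \<iota>"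
    and unimod: "unimodular \<iota>"
    and L_linear: "linear L"
    and L_self_adjoint: "\<And>a b. L a \<bullet> b = a \<bullet> L b"
    and bracket: "\<And>a b. la_bracket (\<iota> a) (\<iota> b) = \<iota> (L (cross3 a b))"
    and u_deriv: "\<And>t. (u has_vector_derivative u' t) (at t)"
    and euler_arnold: "\<And>t. u' t = - cross3 (u t) (L (u t))"
    and nonsteady: "\<not> (\<exists>c. \<forall>t. u t = c)"
    and unit_speed: "\<And>t. u t \<bullet> u t = 1"
    and curve: "smooth_curve_on UNIV \<gamma>"
    and velocity_eq: "\<And>t. velocity \<gamma> t = DL (\<gamma> t) (\<iota> (u t))"
    and l_def: "l = u 0 \<bullet> L (u 0)"
    and \<delta>_def: "\<And>t. \<delta> t = (norm (u' t))\<^sup>2"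
    and v_def: "\<And>t. v t = (1 / \<delta> t) *\<^sub>R u' t"
    and w_def: "\<And>t. w t = L (u t) - l *\<^sub>R u t"
    and \<xi>_def: "\<And>t. \<xi> t = (1 / (\<delta> t)\<^sup>2) *
      (cross3 (u t) (L (u t)) \<bullet> (cross3 (u t) (L (L (u t))) - L (cross3 (u t) (L (u t)))))"
  shows "(\<forall>t. u t \<bullet> L (u t) = l) \<and>
    (\<forall>\<tau> p q r. 0 < \<tau> \<longrightarrow>
       p piecewise_C1_differentiable_on {0..\<tau>} \<longrightarrow>
       q piecewise_C1_differentiable_on {0..\<tau>} \<longrightarrow>
       r piecewise_C1_differentiable_on {0..\<tau>} \<longrightarrow>
       p 0 = 0 \<and> q 0 = 0 \<and> r 0 = 0 \<and> p \<tau> = 0 \<and> q \<tau> = 0 \<and> r \<tau> = 0 \<longrightarrow>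
       index_form M N \<iota> \<gamma> \<tau>
         (\<lambda>t. DL (\<gamma> t) (\<iota> (p t *\<^sub>R u t + q t *\<^sub>R v t + r t *\<^sub>R w t))) =
       integral {0..\<tau>} (\<lambda>t. (deriv p t)\<^sup>2 + \<delta> t * (deriv r t + \<xi> t * q t)\<^sup>2
         + (1 / \<delta> t) * (deriv q t)\<^sup>2 - l * \<xi> t * (q t)\<^sup>2)) \<and>
    (0 \<le> l \<longrightarrow> (\<forall>t\<ge>0. \<xi> t \<le> 0) \<longrightarrow> \<not> (\<exists>t\<^sub>0. conjugate_time N \<iota> \<gamma> t\<^sub>0)) \<and>
    (\<forall>\<delta>\<^sub>0 \<xi>\<^sub>0. 0 < l \<longrightarrow> 0 < \<delta>\<^sub>0 \<longrightarrow> 0 < \<xi>\<^sub>0 \<longrightarrow>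
       (\<forall>t\<ge>0. \<delta>\<^sub>0 \<le> \<delta> t) \<longrightarrow> (\<forall>t\<ge>0. \<xi>\<^sub>0 \<le> \<xi> t) \<longrightarrow>
       (\<exists>t\<^sub>0\<le>2 * pi / sqrt (l * \<xi>\<^sub>0 * \<delta>\<^sub>0). conjugate_time N \<iota> \<gamma> t\<^sub>0))"
proof -
  have sa: "self_adjoint3 L" by (rule self_adjoint3.intro[OF L_linear L_self_adjoint])
  interpret left_invariant_connection L M N \<iota>
    by (rule left_invariant_connection.intro[OF sa
        left_invariant_connection_axioms.intro[OF metric connection iso bracket]])
  interpret euler_arnold_flow L u u' v w l \<delta> \<xi>
    by (rule euler_arnold_flow.intro[OF sa euler_arnold_flow_axioms.intro[OF u_deriv euler_arnold
        nonsteady unit_speed l_def \<delta>_def v_def w_def \<xi>_def]])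
  interpret left_invariant_geodesic L M N \<iota> u u' v w l \<delta> \<xi> \<gamma>
    by unfold_locales (simp only: velocity_eq field_at_def)
  show ?thesis
  proof (intro conjI allI impI notI)
    show "u t \<bullet> L (u t) = l" for t by (rule energy)
  next
    fix \<tau> :: real and p q r :: "real \<Rightarrow> real"
    assume "0 < \<tau>" "p piecewise_C1_differentiable_on {0..\<tau>}" "q piecewise_C1_differentiable_on {0..\<tau>}"
      "r piecewise_C1_differentiable_on {0..\<tau>}" "p 0 = 0 \<and> q 0 = 0 \<and> r 0 = 0 \<and> p \<tau> = 0 \<and> q \<tau> = 0 \<and> r \<tau> = 0"
    then show "index_form M N \<iota> \<gamma> \<tau> (\<lambda>t. DL (\<gamma> t) (\<iota> (p t *\<^sub>R u t + q t *\<^sub>R v t + r t *\<^sub>R w t))) =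
       integral {0..\<tau>} (\<lambda>t. (deriv p t)\<^sup>2 + \<delta> t * (deriv r t + \<xi> t * q t)\<^sup>2
         + (1 / \<delta> t) * (deriv q t)\<^sup>2 - l * \<xi> t * (q t)\<^sup>2)"
      unfolding field_at_def[symmetric] index_form_field_at by (intro index_integral) auto
  next
    assume "0 \<le> l" "\<forall>t\<ge>0. \<xi> t \<le> 0" "\<exists>t\<^sub>0. conjugate_time N \<iota> \<gamma> t\<^sub>0"
    then show False
      unfolding conjugate_time_iff using no_conjugate by metis
  next
    fix \<delta>\<^sub>0 \<xi>\<^sub>0
    assume "0 < l" "0 < \<delta>\<^sub>0" "0 < \<xi>\<^sub>0" "\<forall>t\<ge>0. \<delta>\<^sub>0 \<le> \<delta> t" "\<forall>t\<ge>0. \<xi>\<^sub>0 \<le> \<xi> t"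
    then obtain s y h where s: "0 < s" "s \<le> 2 * pi / sqrt (l * \<xi>\<^sub>0 * \<delta>\<^sub>0)"
      and y: "linearized y h" "y 0 = 0" "y s = 0" "h 0 \<noteq> 0"
      using conjugate_exists[of \<delta>\<^sub>0 \<xi>\<^sub>0] by auto
    \<comment> \<open>Nontriviality is known for \<open>h 0\<close> only. If \<open>y\<close>
      vanished identically, so would h = y' + L (u \<times> y).\<close>
    have "\<exists>t. y t \<noteq> 0"
    proof (rule ccontr)
      assume "\<nexists>t. y t \<noteq> 0"
      then have zero: "y = (\<lambda>t. 0)" by auto
      have "h 0 - L (cross3 (u 0) (y 0)) = 0"
        using linearized_deriv(1)[OF y(1), of 0] unfolding zero
        by (rule vector_derivative_unique_at) (rule has_vector_derivative_const)
      then show False using y by (simp add: L_simps)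
    qed
    with s y have "conjugate_time N \<iota> \<gamma> s" unfolding conjugate_time_iff by blast
    with s show "\<exists>t\<^sub>0\<le>2 * pi / sqrt (l * \<xi>\<^sub>0 * \<delta>\<^sub>0). conjugate_time N \<iota> \<gamma> t\<^sub>0" by blast
  qed
qed

end
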